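(* Let $\mathcal{V}$ be a complex vector space, $\Omega\subset\mathcal{V}_{\rm nc}$ an arbitrary set of nc points, $\mathcal{Y}$ a Hilbert space, $\mathcal{A}$ a unital $C^*$-algebra and $\mathbb{S}\subset\mathcal{A}$ an operator system (a unital $*$-closed linear subspace). Let $K$ be a completely positive nc kernel on $\Omega$ with values in $\mathcal{L}(\mathbb{S}_{\rm nc},\mathcal{L}(\mathcal{Y})_{\rm nc})$. Then there exists a completely positive nc kernel $\widehat K$ on $\Omega$ with values in $\mathcal{L}(\mathcal{A}_{\rm nc},\mathcal{L}(\mathcal{Y})_{\rm nc})$ such that $\widehat K(Z,W)(P)=K(Z,W)(P)$ for all $Z\in\Omega_n$, $W\in\Omega_m$, $n,m\in\mathbb{N}$, whenever $P\in\mathbb{S}^{n\times m}$.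
   Context: $\mathcal{V}_{\rm nc}=\amalg_{n\ge1}\mathcal{V}^{n\times n}$; $\Omega_n=\Omega\cap\mathcal{V}^{n\times n}$; complex matrices act on matrices over $\mathcal{V}$, $\mathcal{A}$, $\mathbb{S}$, $\mathcal{L}(\mathcal{Y})$ by matrix multiplication. For $\mathbb{X}=\mathcal{A}$ or $\mathbb{X}=\mathbb{S}$, a nc kernel on $\Omega$ with values in $\mathcal{L}(\mathbb{X}_{\rm nc},\mathcal{L}(\mathcal{Y})_{\rm nc})$ is a function $K$ on $\Omega\times\Omega$ such that (graded) $K(Z,W)$ is a linear map $\mathbb{X}^{n\times m}\to\mathcal{L}(\mathcal{Y})^{n\times m}$ for $Z\in\Omega_n$, $W\in\Omega_m$; and (respects intertwinings) whenever $Z\in\Omega_n$, $\widetilde Z\in\Omega_{\tilde n}$, $\alpha\in\mathbb{C}^{\tilde n\times n}$, $\alpha Z=\widetilde Z\alpha$, $W\in\Omega_m$, $\widetilde W\in\Omega_{\tilde m}$, $\beta\in\mathbb{C}^{\tilde m\times m}$, $\beta W=\widetilde W\beta$, $P\in\mathbb{X}^{n\times m}$, then $\alpha K(Z,W)(P)\beta^*=K(\widetilde Z,\widetilde W)(\alpha P\beta^* )$. Such a $K$ is completely positive (cp) if for all finite lists $Z_1,\dots,Z_k$ in $\Omega$, $Z_i\in\Omega_{n_i}$, the map $[P_{ij}]\mapsto[K(Z_i,Z_j)(P_{ij})]$ ($P_{ij}\in\mathbb{X}^{n_i\times n_j}$) from $\mathbb{X}^{N\times N}\subset\mathcal{A}^{N\times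 N}$ to $\mathcal{L}(\mathcal{Y})^{N\times N}\cong\mathcal{L}(\mathcal{Y}^N)$, $N=\sum n_i$, is completely positive. *)

theory Defs
  imports Complex_Main "Jordan_Normal_Form.Schur_Decomposition"
begin

class scaleC =
  fixes scaleC :: "complex \<Rightarrow> 'a \<Rightarrow> 'a"  (infixr \<open>*\<^sub>C\<close> 75)

class complex_vector = ab_group_add + scaleC +
  assumes scaleC_add_right: "c *\<^sub>C (x + y) = c *\<^sub>C x + c *\<^sub>C y"
    and scaleC_add_left: "(c + d) *\<^sub>C x = c *\<^sub>C x + d *\<^sub>C x"
    and scaleC_scaleC: "c *\<^sub>C (d *\<^sub>C x) = (c * d) *\<^sub>C x"
    and scaleC_one: "1 *\<^sub>C x = x"

lemma vector_space_scaleC: "vector_space (scaleC :: complex \<Rightarrow> 'a::complex_vector \<Rightarrow> 'a)"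
  by unfold_locales (simp_all add: scaleC_add_right scaleC_add_left scaleC_scaleC scaleC_one)

class complex_normed_vector = complex_vector + real_normed_vector +
  assumes scaleR_scaleC: "r *\<^sub>R x = complex_of_real r *\<^sub>C x"
    and norm_scaleC: "norm (c *\<^sub>C x) = cmod c * norm x"

text \<open>The inner product is linear in the first argument.\<close>

class chilbert_space = complex_normed_vector + complete_space +
  fixes cinner :: "'a \<Rightarrow> 'a \<Rightarrow> complex"
  assumes cinner_commute: "cinner x y = cnj (cinner y x)"
    and cinner_add_left: "cinner (x + y) z = cinner x z + cinner y z"
    and cinner_scaleC_left: "cinner (c *\<^sub>C x) y = c * cinner x y"
    and cinner_ge_zero: "0 \<le> Re (cinner x x)"
    and cinner_eq_zero_iff: "cinner x x = 0 \<longleftrightarrow> x = 0"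
    and norm_eq_sqrt_cinner: "norm x = sqrt (Re (cinner x x))"

text \<open>The class \<open>real_normed_algebra_1\<close> is avoided on purpose: it would exclude the zero algebra.
  For a nonzero algebra \<open>norm 1 = 1\<close> follows from the C*-identity.\<close>

class cstar_algebra = real_normed_algebra + monoid_mult + complex_normed_vector + complete_space +
  fixes star :: "'a \<Rightarrow> 'a"
  assumes mult_scaleC_left: "(c *\<^sub>C x) * y = c *\<^sub>C (x * y)"
    and mult_scaleC_right: "x * (c *\<^sub>C y) = c *\<^sub>C (x * y)"
    and star_star: "star (star x) = x"
    and star_add: "star (x + y) = star x + star y"
    and star_scaleC: "star (c *\<^sub>C x) = cnj c *\<^sub>C star x"
    and star_mult: "star (x * y) = star y * star x"
    and cstar_identity: "norm (star x * x) = (norm x)\<^sup>2"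

definition operator_system :: "'a::cstar_algebra set \<Rightarrow> bool" where
  "operator_system S \<longleftrightarrow> Modules.module.subspace scaleC S \<and> 1 \<in> S \<and> (\<forall>x\<in>S. star x \<in> S)"

typedef (overloaded) 'y bop =
  "{f :: 'y::complex_normed_vector \<Rightarrow> 'y. bounded_linear f \<and> (\<forall>c x. f (c *\<^sub>C x) = c *\<^sub>C f x)}"
  morphisms bop_apply Bop
  by (rule exI[of _ "\<lambda>x. x"]) (simp add: bounded_linear_ident)

setup_lifting type_definition_bop

lemma scaleC_zero_right [simp]: "c *\<^sub>C (0::'a::complex_vector) = 0"
  using scaleC_add_right[of c 0 "0::'a"] by simp

lemma scaleC_minus_right: "c *\<^sub>C (- x :: 'a::complex_vector) = - (c *\<^sub>C x)"
  using scaleC_add_right[of c x "- x"] by (simp add: eq_neg_iff_add_eq_0 add.commute)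

lemma scaleC_diff_right: "c *\<^sub>C (x - y :: 'a::complex_vector) = c *\<^sub>C x - c *\<^sub>C y"
  using scaleC_add_right[of c x "- y"] by (simp add: scaleC_minus_right)

lemma bounded_linear_scaleC: "bounded_linear (\<lambda>x::'a::complex_normed_vector. c *\<^sub>C x)"
  by (rule bounded_linear_intro[where K = "cmod c"])
     (simp_all add: scaleC_add_right scaleR_scaleC scaleC_scaleC norm_scaleC mult.commute)

instantiation bop :: (complex_normed_vector) complex_vector
begin

lift_definition zero_bop :: "'a bop" is "\<lambda>x. 0" by simp

lift_definition plus_bop :: "'a bop \<Rightarrow> 'a bop \<Rightarrow> 'a bop" is "\<lambda>f g x. f x + g x"
  by (simp add: bounded_linear_add scaleC_add_right)

lift_definition uminus_bop :: "'a bop \<Rightarrow> 'a bop" is "\<lambda>f x. - f x"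
  by (simp add: bounded_linear_minus scaleC_minus_right)

lift_definition minus_bop :: "'a bop \<Rightarrow> 'a bop \<Rightarrow> 'a bop" is "\<lambda>f g x. f x - g x"
  by (simp add: bounded_linear_sub scaleC_diff_right)

lift_definition scaleC_bop :: "complex \<Rightarrow> 'a bop \<Rightarrow> 'a bop" is "\<lambda>c f x. c *\<^sub>C f x"
  by (auto simp: scaleC_scaleC mult.commute
      intro: bounded_linear_compose[OF bounded_linear_scaleC])

instance
  by intro_classes
     (transfer; simp add: fun_eq_iff scaleC_add_right scaleC_add_left scaleC_scaleC scaleC_one)+

end

definition mats :: "'b set \<Rightarrow> nat \<Rightarrow> nat \<Rightarrow> 'b mat set" where
  "mats X n m = {P \<in> carrier_mat n m. elements_mat P \<subseteq> X}"

definition lact :: "complex mat \<Rightarrow> 'b::complex_vector mat \<Rightarrow> 'b mat" where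
  "lact \<alpha> M = mat (dim_row \<alpha>) (dim_col M) (\<lambda>(i,j). \<Sum>k<dim_row M. (\<alpha> $$ (i,k)) *\<^sub>C (M $$ (k,j)))"

definition ract :: "'b::complex_vector mat \<Rightarrow> complex mat \<Rightarrow> 'b mat" where
  "ract M \<beta> = mat (dim_row M) (dim_col \<beta>) (\<lambda>(i,j). \<Sum>k<dim_col M. (\<beta> $$ (k,j)) *\<^sub>C (M $$ (i,k)))"

definition linear_on_mats ::
    "'b::complex_vector mat set \<Rightarrow> ('b mat \<Rightarrow> 'c::complex_vector mat) \<Rightarrow> bool" where
  "linear_on_mats D \<phi> \<longleftrightarrow>
     (\<forall>P\<in>D. \<forall>Q\<in>D. \<phi> (P + Q) = \<phi> P + \<phi> Q) \<and>
     (\<forall>c. \<forall>P\<in>D. \<phi> (map_mat (scaleC c) P) = map_mat (scaleC c) (\<phi> P))"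

text \<open>
  Block matrices for a partition \<open>ns = [n\<^sub>0, ..., n\<^sub>k\<^sub>-\<^sub>1]\<close> of \<open>N = sum_list ns\<close>:
  \<open>locate ns r = (i, r')\<close> says that index \<open>r < N\<close> is position \<open>r'\<close> of part \<open>i\<close>,
  \<open>assemble ns Q\<close> is the \<open>N\<close> by \<open>N\<close> matrix with blocks \<open>Q i j\<close>,
  and \<open>block ns P i j\<close> is the block of \<open>P\<close> at \<open>(i, j)\<close>.
\<close>

fun locate :: "nat list \<Rightarrow> nat \<Rightarrow> nat \<times> nat" where
  "locate [] r = (0, r)"
| "locate (n # ns) r =
     (if r < n then (0, r) else let (i, r') = locate ns (r - n) in (Suc i, r'))"

definition assemble :: "nat list \<Rightarrow> (nat \<Rightarrow> nat \<Rightarrow> 'b mat) \<Rightarrow> 'b mat" where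
  "assemble ns Q = mat (sum_list ns) (sum_list ns)
     (\<lambda>(r,c). let (i, r') = locate ns r; (j, c') = locate ns c in Q i j $$ (r', c'))"

definition block :: "nat list \<Rightarrow> 'b mat \<Rightarrow> nat \<Rightarrow> nat \<Rightarrow> 'b mat" where
  "block ns P i j = mat (ns ! i) (ns ! j)
     (\<lambda>(r,c). P $$ (sum_list (take i ns) + r, sum_list (take j ns) + c))"

definition star_mat :: "'a::cstar_algebra mat \<Rightarrow> 'a mat" where
  "star_mat B = mat (dim_col B) (dim_row B) (\<lambda>(i,j). star (B $$ (j,i)))"

text \<open>The \<open>N\<close> by \<open>N\<close> matrices over \<open>\<A>\<close> form a C*-algebra, whose positive elements are the \<open>B\<^sup>*B\<close>;
  stated this way, positivity does not refer to the C*-norm on matrices.\<close>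

definition cstar_positive :: "nat \<Rightarrow> 'a::cstar_algebra mat \<Rightarrow> bool" where
  "cstar_positive N P \<longleftrightarrow> (\<exists>B \<in> carrier_mat N N. P = star_mat B * B)"

text \<open>Positivity of an \<open>N\<close> by \<open>N\<close> matrix of operators on \<open>\<Y>\<close>, regarded as the operator
  \<open>y \<mapsto> (\<Sum>j. T\<^sub>i\<^sub>j y\<^sub>j)\<^sub>i\<close> on the Hilbert space \<open>\<Y>\<^sup>N\<close>: the number \<open>\<langle>T y, y\<rangle>\<close> is nonnegative.\<close>

definition op_positive :: "nat \<Rightarrow> 'y::chilbert_space bop mat \<Rightarrow> bool" where
  "op_positive N T \<longleftrightarrow> T \<in> carrier_mat N N \<and>
     (\<forall>y \<in> carrier_vec N.
        let q = (\<Sum>i<N. cinner (\<Sum>j<N. bop_apply (T $$ (i,j)) (y $ j)) (y $ i))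
        in Im q = 0 \<and> 0 \<le> Re q)"

text \<open>Complete positivity of a map from \<open>N\<close> by \<open>N\<close> matrices over \<open>S\<close> to \<open>N\<close> by \<open>N\<close> matrices of
  operators. For every \<open>k\<close>, the \<open>k\<close> by \<open>k\<close> ampliation is positive; a \<open>k\<close> by \<open>k\<close> matrix of
  \<open>N\<close> by \<open>N\<close> matrices is identified with a \<open>kN\<close> by \<open>kN\<close> matrix. Positivity of an element over
  \<open>S\<close> is positivity over the ambient C*-algebra.\<close>

definition completely_positive ::
    "'a::cstar_algebra set \<Rightarrow> nat \<Rightarrow> ('a mat \<Rightarrow> 'y::chilbert_space bop mat) \<Rightarrow> bool" where
  "completely_positive S N \<phi> \<longleftrightarrow>
     \<phi> \<in> mats S N N \<rightarrow> carrier_mat N N \<and> linear_on_mats (mats S N N) \<phi> \<and>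
     (\<forall>k Q. (\<forall>a<k. \<forall>b<k. Q a b \<in> mats S N N) \<longrightarrow>
        cstar_positive (k * N) (assemble (replicate k N) Q) \<longrightarrow>
        op_positive (k * N) (assemble (replicate k N) (\<lambda>a b. \<phi> (Q a b))))"

text \<open>A point of \<open>\<V>\<^sub>n\<^sub>c\<close> is a square matrix over \<open>\<V>\<close> of arbitrary positive size;
  the size of a point \<open>Z\<close> is \<open>dim_row Z\<close>.\<close>

definition nc_space :: "'v mat set" where
  "nc_space = (\<Union>n\<in>{1..}. carrier_mat n n)"

definition graded_level :: "'v mat set \<Rightarrow> nat \<Rightarrow> 'v mat set" where
  "graded_level \<Omega> n = \<Omega> \<inter> carrier_mat n n"

text \<open>The values \<open>K Z W P\<close> are only relevant for \<open>Z, W \<in> \<Omega>\<close> and \<open>P\<close> over \<open>X\<close> of the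
  matching size.\<close>

definition nc_kernel :: "'v::complex_vector mat set \<Rightarrow> 'a::cstar_algebra set \<Rightarrow>
    ('v mat \<Rightarrow> 'v mat \<Rightarrow> 'a mat \<Rightarrow> 'y::chilbert_space bop mat) \<Rightarrow> bool" where
  "nc_kernel \<Omega> X K \<longleftrightarrow>
     (\<forall>n m. \<forall>Z \<in> graded_level \<Omega> n. \<forall>W \<in> graded_level \<Omega> m.
        K Z W \<in> mats X n m \<rightarrow> carrier_mat n m \<and> linear_on_mats (mats X n m) (K Z W)) \<and>
     (\<forall>n n' m m'. \<forall>Z \<in> graded_level \<Omega> n. \<forall>Z' \<in> graded_level \<Omega> n'.
        \<forall>W \<in> graded_level \<Omega> m. \<forall>W' \<in> graded_level \<Omega> m'.
        \<forall>\<alpha> \<in> carrier_mat n' n. \<forall>\<beta> \<in> carrier_mat m' m. \<forall>P \<in> mats X n m.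
        lact \<alpha> Z = ract Z' \<alpha> \<longrightarrow> lact \<beta> W = ract W' \<beta> \<longrightarrow>
        ract (lact \<alpha> (K Z W P)) (mat_adjoint \<beta>) =
          K Z' W' (ract (lact \<alpha> P) (mat_adjoint \<beta>)))"

definition cp_nc_kernel :: "'v::complex_vector mat set \<Rightarrow> 'a::cstar_algebra set \<Rightarrow>
    ('v mat \<Rightarrow> 'v mat \<Rightarrow> 'a mat \<Rightarrow> 'y::chilbert_space bop mat) \<Rightarrow> bool" where
  "cp_nc_kernel \<Omega> X K \<longleftrightarrow> nc_kernel \<Omega> X K \<and>
     (\<forall>Zs. set Zs \<subseteq> \<Omega> \<longrightarrow>
        (let ns = map dim_row Zs in
          completely_positive X (sum_list ns)
            (\<lambda>P. assemble ns (\<lambda>i j. K (Zs ! i) (Zs ! j) (block ns P i j)))))"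

end

theory Submission
  imports Defs "HOL-Library.Poly_Mapping" "HOL-Computational_Algebra.Formal_Power_Series"
begin

text \<open>
  Encode the kernel as scalar forms \<open>\<sigma> a g h\<close> indexed by generators \<open>g = (Z, k, i, y)\<close>: for \<open>a\<close> in
  the operator system, \<open>\<sigma> a (Z, k, i, y) (W, l, j, x)\<close> is the number \<open>\<langle>K(Z, W)(a E\<^sub>k\<^sub>l)\<^sub>i\<^sub>j x, y\<rangle>\<close>. Complete
  positivity says that the induced functional on finitely supported matrices indexed by generators
  is nonnegative on Gram matrices. Since \<open>c - a\<^sup>*a\<close> has a square root for large \<open>c\<close>, matrices over
  the operator system dominate all matrices over the algebra, and the functional extends by the
  Riesz extension theorem, with no regard to linearity in \<open>y\<close> or to intertwinings. These are
  automatic: they are linear relations that hold for the form at \<open>1\<close>, which is unchanged, and by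
  Cauchy--Schwarz they pass to the form at every element of the algebra. The same inequality gives
  the bounds under which the extended forms are represented by operators on \<open>\<Y>\<close>.
\<close>

section \<open>Square roots in C*-algebras\<close>

text \<open>Extending the map of each finite list separately would leave two tasks: making the
  extensions agree across lists, and making them respect intertwinings. One functional on matrices
  indexed by all generators settles the first, since every finite list lives inside it. The vectors
  \<open>y\<close> enter as bare labels, so no tensor product or quotient is formed; its relations
  are recovered afterwards as null combinations of generators. For the intertwinings,
  \<open>lact \<alpha> Z = ract Z' \<alpha>\<close> makes the combination of the
  \<open>(Z, k, i, y)\<close> with coefficients \<open>\<alpha> $$ (i', i)\<close> and the
  combination of the \<open>(Z', k', i', y)\<close> with coefficients
  \<open>\<alpha> $$ (k', k)\<close> indistinguishable at \<open>1\<close>. The passage from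
  \<open>1\<close> to \<open>a\<close> uses a row with entry \<open>a\<close> at one generator and
  scalars at the others: its positivity bounds the square of the mixed term by the value at
  \<open>star a * a\<close> times the value of the form at \<open>1\<close> on the scalar part. The
  extension step is real: it extends the real part of the pairing, and the complex form is rebuilt
  from the values at \<open>a\<close> and at \<open>\<i> *\<^sub>C a\<close>.\<close>

instance cstar_algebra \<subseteq> banach ..

lemma star_zero [simp]: "star (0::'a::cstar_algebra) = 0"
  using star_add[of 0 "0::'a"] by simp

lemma star_minus: "star (- x :: 'a::cstar_algebra) = - star x"
  using star_add[of x "- x"] by (simp add: eq_neg_iff_add_eq_0 add.commute)

lemma star_one [simp]: "star (1::'a::cstar_algebra) = 1"
  by (metis mult.right_neutral star_mult star_star)

lemma star_scaleR: "star (r *\<^sub>R x :: 'a::cstar_algebra) = r *\<^sub>R star x"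
  by (simp add: scaleR_scaleC star_scaleC)

lemma star_sum: "star (sum f I :: 'a::cstar_algebra) = (\<Sum>i\<in>I. star (f i))"
  by (induction I rule: infinite_finite_induct) (simp_all add: star_add)

lemma star_power: "star (x ^ n :: 'a::cstar_algebra) = star x ^ n"
  by (induction n) (simp_all add: star_mult power_commutes)

lemma norm_star: "norm (star x :: 'a::cstar_algebra) = norm x"
proof -
  have le: "norm y \<le> norm (star y)" for y :: 'a
  proof (cases "norm y = 0")
    case False
    have "norm y * norm y \<le> norm (star y) * norm y"
      using norm_mult_ineq[of "star y" y] cstar_identity[of y] by (simp add: power2_eq_square)
    with False show ?thesis by simp
  qed simp
  from le[of x] le[of "star x"] show ?thesis by (simp add: star_star)
qed

lemma bounded_linear_star: "bounded_linear (star :: 'a::cstar_algebra \<Rightarrow> 'a)"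
  by (rule bounded_linear_intro[where K = 1]) (simp_all add: star_add star_scaleR norm_star)

text \<open>The root is the binomial series with coefficients \<open>1/2 gchoose n\<close>. The
  ratio of consecutive coefficients has modulus at most 1, so the series converges absolutely for
  \<open>norm h < 1\<close>, and Vandermonde's identity turns its Cauchy square into the series with
  coefficients \<open>1 gchoose k\<close>, which stops after \<open>k = 1\<close>.\<close>

lemma self_adjoint_sqrt_one_plus:
  fixes h :: "'a::cstar_algebra"
  assumes "star h = h" and "norm h < 1"
  shows "\<exists>d. star d = d \<and> d * d = 1 + h"
proof -
  define c :: "nat \<Rightarrow> real" where "c n = (1/2 gchoose n)" for n
  define s where "s n = c n *\<^sub>R h ^ n" for n
  have c_le: "\<bar>c n\<bar> \<le> 1" for n
  proof (induction n)
    case (Suc n)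
    have "c (Suc n) = c n * ((1/2 - real n) / real (Suc n))"
      using gbinomial_mult_1[of "1/2::real" n] by (simp add: c_def field_simps)
    moreover have "\<bar>(1/2 - real n) / real (Suc n)\<bar> \<le> 1"
      by (simp add: abs_le_iff field_simps)
    ultimately show ?case
      using mult_mono[OF Suc.IH, of "\<bar>(1/2 - real n) / real (Suc n)\<bar>" 1] by (simp add: abs_mult)
  qed (simp add: c_def)
  have norm_h: "norm (h ^ n) \<le> norm (1::'a) * norm h ^ n" for n
  proof (induction n)
    case (Suc n)
    have "norm (h ^ Suc n) \<le> norm h * norm (h ^ n)" by (simp add: norm_mult_ineq)
    also have "\<dots> \<le> norm h * (norm (1::'a) * norm h ^ n)"
      using Suc.IH by (intro mult_left_mono) auto
    finally show ?case by (simp add: mult_ac)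
  qed simp
  have s_le: "norm (s n) \<le> norm (1::'a) * norm h ^ n" for n
    using mult_mono[OF c_le norm_h, of n n] by (simp add: s_def)
  have sum_norm: "summable (\<lambda>n. norm (s n))"
    by (rule summable_comparison_test[OF _ summable_mult[OF summable_geometric[of "norm h"], of "norm (1::'a)"]])
       (use s_le assms(2) in auto)
  hence summ: "summable s" by (rule summable_norm_cancel)
  define d where "d = suminf s"
  have "star (s n) = s n" for n by (simp add: s_def star_scaleR star_power assms(1))
  hence "star d = d"
    using bounded_linear.suminf[OF bounded_linear_star summ] by (simp add: d_def)
  moreover have "d * d = 1 + h"
  proof -
    have "(\<Sum>i\<le>k. s i * s (k - i)) = (1 gchoose k) *\<^sub>R h ^ k" for k
    proof -
      have "(\<Sum>i\<le>k. s i * s (k - i)) = (\<Sum>i\<le>k. (c i * c (k - i)) *\<^sub>R h ^ k)"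
        by (rule sum.cong[OF refl]) (simp add: s_def flip: power_add)
      also have "\<dots> = (\<Sum>i\<in>{0..k}. c i * c (k - i)) *\<^sub>R h ^ k"
        by (simp add: scaleR_left.sum atLeast0AtMost)
      also have "\<dots> = (1 gchoose k) *\<^sub>R h ^ k"
        using gbinomial_Vandermonde[of "1/2::real" "1/2" k] by (simp add: c_def)
      finally show ?thesis .
    qed
    with Cauchy_product_sums[OF sum_norm sum_norm]
    have "(\<lambda>k. (1 gchoose k) *\<^sub>R h ^ k) sums (d * d)" by (simp add: d_def)
    moreover have "(\<lambda>k. (1 gchoose k) *\<^sub>R h ^ k) sums (\<Sum>k\<in>{0,1}. (1 gchoose k) *\<^sub>R h ^ k)"
    proof (rule sums_finite)
      fix k :: nat assume "k \<notin> {0,1}"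
      hence "(1 choose k) = 0" by (intro binomial_eq_0) auto
      hence "(1 gchoose k) = (0::real)"
        using binomial_gbinomial[of 1 k, where ?'a = real] by (metis of_nat_0 of_nat_1)
      thus "(1 gchoose k) *\<^sub>R h ^ k = 0" by simp
    qed simp
    ultimately have "d * d = (\<Sum>k\<in>{0,1}. (1 gchoose k) *\<^sub>R h ^ k)" by (rule sums_unique2)
    thus ?thesis by simp
  qed
  ultimately show ?thesis by blast
qed

text \<open>This explicit witness stands in for the order of the algebra:
  \<open>c - star a * a\<close> is a positive element because \<open>1 - star a * a / c\<close> has
  a self-adjoint root. The summand 1 in \<open>c\<close> keeps \<open>c\<close> positive and the
  norm of \<open>h\<close> strictly below 1, also for \<open>a = 0\<close>.\<close>

lemma star_mult_self_le_scaleR_one: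
  fixes a :: "'a::cstar_algebra"
  shows "\<exists>c>0. \<exists>d. star a * a + star d * d = c *\<^sub>R 1"
proof -
  define c where "c = (norm a)\<^sup>2 + 1"
  have c: "c > 0" by (simp add: c_def add_nonneg_pos)
  define h where "h = - ((1 / c) *\<^sub>R (star a * a))"
  have "star h = h" by (simp add: h_def star_minus star_scaleR star_mult star_star)
  moreover have "norm h < 1" using c by (simp add: h_def cstar_identity c_def)
  ultimately obtain d where d: "star d = d" "d * d = 1 + h"
    using self_adjoint_sqrt_one_plus by blast
  have "star (sqrt c *\<^sub>R d) * (sqrt c *\<^sub>R d) = c *\<^sub>R (1 + h)"
    using c by (simp add: star_scaleR d)
  hence "star a * a + star (sqrt c *\<^sub>R d) * (sqrt c *\<^sub>R d) = c *\<^sub>R 1"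
    using c by (simp add: h_def scaleR_right_distrib scaleR_diff_right)
  with c show ?thesis by blast
qed

section \<open>Extension of positive functionals\<close>

definition sublinear :: "('v::real_vector \<Rightarrow> real) \<Rightarrow> bool" where
  "sublinear p \<longleftrightarrow> (\<forall>x y. p (x + y) \<le> p x + p y) \<and> (\<forall>r x. r \<ge> 0 \<longrightarrow> p (r *\<^sub>R x) = r * p x)"

lemma sublinear_add: "sublinear p \<Longrightarrow> p (x + y) \<le> p x + p y"
  and sublinear_scaleR: "sublinear p \<Longrightarrow> r \<ge> 0 \<Longrightarrow> p (r *\<^sub>R x) = r * p x"
  by (simp_all add: sublinear_def)

lemma sublinear_minus: "sublinear p \<Longrightarrow> - p (- x) \<le> p x"
  using sublinear_add[of p x "- x"] sublinear_scaleR[of p 0 0] by simp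

text \<open>The pointwise infimum works. It is finite since every member satisfies
  \<open>- p0 (- x) \<le> p x\<close>. Subadditivity needs one member for both summands: of two
  members of the chain, the smaller one serves.\<close>

lemma sublinear_chain_lower_bound:
  assumes "C \<noteq> {}" and sub: "\<And>p. p \<in> C \<Longrightarrow> sublinear p \<and> p \<le> p0"
    and chain: "\<And>p q. p \<in> C \<Longrightarrow> q \<in> C \<Longrightarrow> p \<le> q \<or> q \<le> p"
  shows "\<exists>q. sublinear q \<and> (\<forall>p\<in>C. q \<le> p)"
proof -
  have lower: "- p0 (- x) \<le> p x" if "p \<in> C" for p x
  proof -
    have "p (- x) \<le> p0 (- x)" using sub[OF that] by (simp add: le_fun_def)
    moreover have "- p (- x) \<le> p x" using sub[OF that] by (intro sublinear_minus) simp
    ultimately show ?thesis by linarith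
  qed
  hence bdd: "bdd_below ((\<lambda>p. p x) ` C)" for x by (auto intro!: bdd_belowI)
  define q where "q x = (INF p\<in>C. p x)" for x
  have le: "q x \<le> p x" if "p \<in> C" for p x
    unfolding q_def by (rule cINF_lower[OF bdd that])
  have greatest: "u \<le> q x" if "\<And>p. p \<in> C \<Longrightarrow> u \<le> p x" for u x
    unfolding q_def by (rule cINF_greatest[OF assms(1) that])
  have "q (x + y) \<le> q x + q y" for x y
  proof -
    have step: "q (x + y) \<le> p x + p' y" if p: "p \<in> C" "p' \<in> C" for p p'
      using chain[OF p]
    proof
      assume "p \<le> p'"
      thus ?thesis
        using le[OF p(1), of "x + y"] sublinear_add[of p x y] sub[OF p(1)] le_funD[of p p' y] by linarith
    next
      assume "p' \<le> p"
      thus ?thesis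
        using le[OF p(2), of "x + y"] sublinear_add[of p' x y] sub[OF p(2)] le_funD[of p' p x] by linarith
    qed
    have "q (x + y) - p' y \<le> q x" if "p' \<in> C" for p'
      by (rule greatest) (use step[OF _ that] in fastforce)
    hence "q (x + y) - q x \<le> q y" by (intro greatest) fastforce
    thus ?thesis by simp
  qed
  moreover have "q (r *\<^sub>R x) = r * q x" if r: "r \<ge> 0" for r x
  proof (cases "r = 0")
    case True
    obtain p where "p \<in> C" using assms(1) by auto
    have "p 0 = 0" if "p \<in> C" for p using sublinear_scaleR[of p 0 0] sub[OF that] by simp
    hence "(\<lambda>p. p 0) ` C = (\<lambda>p. 0) ` C" by (rule image_cong[OF refl])
    hence "(\<lambda>p. p 0) ` C = {0}" using assms(1) by (simp add: image_constant_conv)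
    hence "q 0 = 0" by (simp add: q_def)
    with True show ?thesis by simp
  next
    case False
    with r have r: "r > 0" by simp
    have eq: "p (r *\<^sub>R x) = r * p x" if "p \<in> C" for p
      using sublinear_scaleR[of p r x] sub[OF that] r by simp
    have "q (r *\<^sub>R x) / r \<le> q x"
      by (rule greatest) (use le[of _ "r *\<^sub>R x"] eq r in \<open>fastforce simp: field_simps\<close>)
    moreover have "r * q x \<le> q (r *\<^sub>R x)"
    proof (rule greatest)
      fix p assume "p \<in> C"
      thus "r * q x \<le> p (r *\<^sub>R x)" using mult_left_mono[OF le, of p r x] eq[of p] r by simp
    qed
    ultimately show ?thesis using r by (simp add: field_simps)
  qed
  ultimately have "sublinear q" by (simp add: sublinear_def)
  moreover have "\<forall>p\<in>C. q \<le> p" using le by (simp add: le_fun_def)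
  ultimately show ?thesis by blast
qed

text \<open>For fixed \<open>y\<close>, the infimum over \<open>t \<ge> 0\<close> of
  \<open>p (u + t *\<^sub>R y) - t * p y\<close> is again sublinear in \<open>u\<close> and lies
  below \<open>p\<close>, so it equals \<open>p\<close>. Its term with \<open>t = 1\<close> is the
  reverse of subadditivity, and additivity extends homogeneity to negative scalars.\<close>

lemma minimal_sublinear_imp_linear:
  assumes p: "sublinear p" and min: "\<And>q. sublinear q \<Longrightarrow> q \<le> p \<Longrightarrow> q = p"
  shows "linear p"
proof -
  have p0: "p 0 = 0" using sublinear_scaleR[OF p, of 0 0] by simp
  have superadd: "p x + p y \<le> p (x + y)" for x y
  proof -
    define A where "A u = (\<lambda>t. p (u + t *\<^sub>R y) - t * p y) ` {0..}" for u
    have lower: "- p (- u) \<le> z" if z: "z \<in> A u" for u z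
    proof -
      obtain t where t: "t \<ge> 0" "z = p (u + t *\<^sub>R y) - t * p y" using z by (auto simp: A_def)
      have "p (t *\<^sub>R y) \<le> p (u + t *\<^sub>R y) + p (- u)"
        using sublinear_add[OF p, of "u + t *\<^sub>R y" "- u"] by simp
      thus ?thesis using t sublinear_scaleR[OF p, of t y] by simp
    qed
    hence bdd: "bdd_below (A u)" for u by (rule bdd_belowI)
    have ne: "A u \<noteq> {}" for u by (auto simp: A_def)
    define q where "q u = Inf (A u)" for u
    have q_le: "q u \<le> p (u + t *\<^sub>R y) - t * p y" if "t \<ge> 0" for u t
      unfolding q_def using that by (intro cInf_lower bdd) (auto simp: A_def)
    have greatest: "w \<le> q u" if "\<And>t. t \<ge> 0 \<Longrightarrow> w \<le> p (u + t *\<^sub>R y) - t * p y" for w u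
      unfolding q_def using that by (intro cInf_greatest ne) (auto simp: A_def)
    have "q (u + v) \<le> q u + q v" for u v
    proof -
      have step: "q (u + v) \<le> (p (u + t *\<^sub>R y) - t * p y) + (p (v + t' *\<^sub>R y) - t' * p y)"
        if "t \<ge> 0" "t' \<ge> 0" for t t'
      proof -
        have "q (u + v) \<le> p ((u + v) + (t + t') *\<^sub>R y) - (t + t') * p y" using that by (intro q_le) simp
        moreover have "p ((u + v) + (t + t') *\<^sub>R y) \<le> p (u + t *\<^sub>R y) + p (v + t' *\<^sub>R y)"
          using sublinear_add[OF p, of "u + t *\<^sub>R y" "v + t' *\<^sub>R y"] by (simp add: algebra_simps)
        ultimately show ?thesis by (simp add: algebra_simps)
      qed
      have "q (u + v) - (p (v + t' *\<^sub>R y) - t' * p y) \<le> q u" if "t' \<ge> 0" for t'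
        by (rule greatest) (use step[OF _ that] in fastforce)
      hence "q (u + v) - q u \<le> q v" by (intro greatest) fastforce
      thus ?thesis by simp
    qed
    moreover have "q (r *\<^sub>R u) = r * q u" if r: "r \<ge> 0" for r u
    proof (cases "r = 0")
      case True
      have "0 \<le> q 0"
        by (rule greatest) (simp add: sublinear_scaleR[OF p])
      moreover have "q 0 \<le> 0" using q_le[of 0 0] p0 by simp
      ultimately show ?thesis using True by simp
    next
      case False
      with r have r: "r > 0" by simp
      have "q (r *\<^sub>R u) / r \<le> q u"
      proof (rule greatest)
        fix t :: real assume "t \<ge> 0"
        have "q (r *\<^sub>R u) \<le> p (r *\<^sub>R u + (r * t) *\<^sub>R y) - (r * t) * p y"
          using r \<open>t \<ge> 0\<close> by (intro q_le) simp
        also have "p (r *\<^sub>R u + (r * t) *\<^sub>R y) = r * p (u + t *\<^sub>R y)"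
          using sublinear_scaleR[OF p, of r "u + t *\<^sub>R y"] r by (simp add: scaleR_right_distrib)
        finally show "q (r *\<^sub>R u) / r \<le> p (u + t *\<^sub>R y) - t * p y"
          using r by (simp add: field_simps)
      qed
      moreover have "r * q u \<le> q (r *\<^sub>R u)"
      proof (rule greatest)
        fix t :: real assume "t \<ge> 0"
        have "r * q u \<le> r * (p (u + (t / r) *\<^sub>R y) - (t / r) * p y)"
          using r \<open>t \<ge> 0\<close> by (intro mult_left_mono q_le) simp_all
        also have "\<dots> = p (r *\<^sub>R u + t *\<^sub>R y) - t * p y"
          using sublinear_scaleR[OF p, of r "u + (t / r) *\<^sub>R y"] r
          by (simp add: scaleR_right_distrib right_diff_distrib)
        finally show "r * q u \<le> p (r *\<^sub>R u + t *\<^sub>R y) - t * p y" .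
      qed
      ultimately show ?thesis using r by (simp add: field_simps)
    qed
    ultimately have "sublinear q" by (simp add: sublinear_def)
    moreover have "q \<le> p" using q_le[of 0] by (simp add: le_fun_def)
    ultimately have "q = p" by (rule min)
    thus ?thesis using q_le[of 1 x] by simp
  qed
  have add: "p (x + y) = p x + p y" for x y
    using superadd[of x y] sublinear_add[OF p, of x y] by simp
  have "p (- x) = - p x" for x using add[of x "- x"] p0 by simp
  hence "p (r *\<^sub>R x) = r * p x" for r x
    using sublinear_scaleR[OF p, of r x] sublinear_scaleR[OF p, of "- r" x]
    by (cases "r \<ge> 0") (auto simp: scaleR_minus_left)
  with add show ?thesis by (intro linearI) auto
qed

text \<open>Hahn-Banach with Zorn's lemma applied to sublinear functionals on the whole space;
  partially defined linear maps never occur.\<close>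

lemma sublinear_dominates_linear:
  assumes "sublinear p0"
  shows "\<exists>f. linear f \<and> f \<le> p0"
proof -
  define X where "X = {p. sublinear p \<and> p \<le> p0}"
  \<comment> \<open>The order is reversed, so that a maximal element is a minimal
    functional.\<close>
  have po: "partial_order_on X (relation_of (\<lambda>p q. q \<le> p) X)"
    by (rule partial_order_on_relation_ofI) auto
  obtain m where m: "m \<in> X" "\<And>q. q \<in> X \<Longrightarrow> q \<le> m \<Longrightarrow> q = m"
  proof -
    have "\<exists>m\<in>X. \<forall>q\<in>X. q \<le> m \<longrightarrow> q = m"
    proof (rule predicate_Zorn[OF po])
      fix C assume C: "C \<in> Chains (relation_of (\<lambda>p q. q \<le> p) X)"
      show "\<exists>u\<in>X. \<forall>a\<in>C. u \<le> a"
      proof (cases "C = {}")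
        case True thus ?thesis using assms by (auto simp: X_def)
      next
        case False
        have sub: "\<And>p. p \<in> C \<Longrightarrow> sublinear p \<and> p \<le> p0"
          using C by (auto simp: Chains_def relation_of_def X_def)
        have "\<And>p q. p \<in> C \<Longrightarrow> q \<in> C \<Longrightarrow> p \<le> q \<or> q \<le> p"
          using C by (auto simp: Chains_def relation_of_def)
        from sublinear_chain_lower_bound[OF False sub this]
        obtain q where q: "sublinear q" "\<forall>p\<in>C. q \<le> p" by blast
        moreover have "q \<le> p0" using False q(2) sub by (meson equals0I order_trans)
        ultimately show ?thesis by (auto simp: X_def)
      qed
    qed
    thus ?thesis using that by auto
  qed
  have "linear m"
  proof (rule minimal_sublinear_imp_linear)
    show "sublinear m" using m(1) by (simp add: X_def)
    show "q = m" if "sublinear q" "q \<le> m" for q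
      using m that by (auto simp: X_def intro: order_trans)
  qed
  thus ?thesis using m(1) by (auto simp: X_def)
qed

text \<open>Let \<open>p x\<close> be the infimum of \<open>s m\<close> over the \<open>m\<close> in
  \<open>M\<close> that dominate \<open>x\<close>. A linear \<open>f\<close> below \<open>p\<close>
  satisfies \<open>f \<le> s\<close> on \<open>M\<close>, hence equality by passing to negatives;
  and for \<open>x\<close> in \<open>D\<close> the element 0 dominates \<open>- x\<close>, so
  \<open>f (- x) \<le> 0\<close>.\<close>

theorem riesz_extension:
  fixes s :: "'v::real_vector \<Rightarrow> real"
  assumes zero: "0 \<in> M" and add: "\<And>x y. x \<in> M \<Longrightarrow> y \<in> M \<Longrightarrow> x + y \<in> M"
    and scale: "\<And>r x. x \<in> M \<Longrightarrow> r *\<^sub>R x \<in> M"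
    and s_add: "\<And>x y. x \<in> M \<Longrightarrow> y \<in> M \<Longrightarrow> s (x + y) = s x + s y"
    and s_scale: "\<And>r x. x \<in> M \<Longrightarrow> s (r *\<^sub>R x) = r * s x"
    and D_add: "\<And>x y. x \<in> D \<Longrightarrow> y \<in> D \<Longrightarrow> x + y \<in> D"
    and D_scale: "\<And>r x. r \<ge> 0 \<Longrightarrow> x \<in> D \<Longrightarrow> r *\<^sub>R x \<in> D"
    and pos: "\<And>x. x \<in> M \<Longrightarrow> x \<in> D \<Longrightarrow> s x \<ge> 0"
    and dom: "\<And>x. \<exists>m\<in>M. m - x \<in> D"
  shows "\<exists>f. linear f \<and> (\<forall>x\<in>M. f x = s x) \<and> (\<forall>x\<in>D. f x \<ge> 0)"
proof -
  define A where "A x = s ` {m \<in> M. m - x \<in> D}" for x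
  have D0: "0 \<in> D" using dom[of 0] D_scale[of 0] by auto
  have s0: "s 0 = 0" using s_scale[OF zero, of 0] by simp
  have ne: "A x \<noteq> {}" for x using dom[of x] by (auto simp: A_def)
  \<comment> \<open>If \<open>m\<close> dominates \<open>x\<close> and \<open>m'\<close> dominates
    \<open>- x\<close>, then \<open>m + m'\<close> lies in both \<open>M\<close> and
    \<open>D\<close>, so \<open>s m\<close> is at least \<open>- s m'\<close>.\<close>
  have bdd: "bdd_below (A x)" for x
  proof -
    obtain m' where m': "m' \<in> M" "m' - (- x) \<in> D" using dom[of "- x"] by auto
    have "- s m' \<le> s m" if m: "m \<in> M" "m - x \<in> D" for m
      using pos[of "m + m'"] add[of m m'] D_add[OF m(2) m'(2)] m m' s_add[of m m'] by simp
    thus ?thesis by (intro bdd_belowI[of _ "- s m'"]) (auto simp: A_def)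
  qed
  define p where "p x = Inf (A x)" for x
  have p_le: "p x \<le> s m" if "m \<in> M" "m - x \<in> D" for m x
    unfolding p_def using that by (intro cInf_lower bdd) (auto simp: A_def)
  have greatest: "w \<le> p x" if "\<And>m. m \<in> M \<Longrightarrow> m - x \<in> D \<Longrightarrow> w \<le> s m" for w x
    unfolding p_def using that by (intro cInf_greatest ne) (auto simp: A_def)
  have "p (x + y) \<le> p x + p y" for x y
  proof -
    have step: "p (x + y) \<le> s m + s m'" if "m \<in> M" "m - x \<in> D" "m' \<in> M" "m' - y \<in> D" for m m'
      using p_le[of "m + m'" "x + y"] D_add[OF that(2,4)] add[of m m'] s_add[of m m'] that
      by (simp add: algebra_simps)
    have "p (x + y) - s m' \<le> p x" if "m' \<in> M" "m' - y \<in> D" for m'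
      by (rule greatest) (use step[OF _ _ that] in fastforce)
    hence "p (x + y) - p x \<le> p y" by (intro greatest) fastforce
    thus ?thesis by simp
  qed
  moreover have "p (r *\<^sub>R x) = r * p x" if r: "r \<ge> 0" for r x
  proof (cases "r = 0")
    case True
    have "p 0 \<le> 0" using p_le[OF zero, of 0] D0 s0 by simp
    moreover have "0 \<le> p 0" using pos by (intro greatest) simp
    ultimately show ?thesis using True by simp
  next
    case False
    with r have r: "r > 0" by simp
    \<comment> \<open>One inequality suffices: applied to \<open>1 / r\<close> and
      \<open>r *\<^sub>R x\<close> it gives the other.\<close>
    have le: "p (t *\<^sub>R u) \<le> t * p u" if t: "t > 0" for t u
    proof -
      have "p (t *\<^sub>R u) / t \<le> p u"
      proof (rule greatest)
        fix m assume m: "m \<in> M" "m - u \<in> D"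
        have "p (t *\<^sub>R u) \<le> s (t *\<^sub>R m)"
          using scale[OF m(1)] D_scale[OF _ m(2), of t] t by (intro p_le) (auto simp: scaleR_diff_right)
        thus "p (t *\<^sub>R u) / t \<le> s m" using t s_scale[OF m(1)] by (simp add: field_simps)
      qed
      thus ?thesis using t by (simp add: field_simps)
    qed
    from le[OF r, of x] le[of "1 / r" "r *\<^sub>R x"] r show ?thesis by (simp add: field_simps)
  qed
  ultimately have "sublinear p" by (simp add: sublinear_def)
  then obtain f where f: "linear f" "f \<le> p" using sublinear_dominates_linear by blast
  have f_neg: "f (- x) = - f x" for x by (rule linear_neg[OF f(1)])
  have f_le: "f x \<le> s x" if "x \<in> M" for x
    using p_le[of x x] D0 f(2) that le_funD[OF f(2), of x] by simp
  have "f x = s x" if x: "x \<in> M" for x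
    using f_le[OF x] f_le[OF scale[OF x, of "-1"]] s_scale[OF x, of "-1"] f_neg[of x] by simp
  moreover have "f x \<ge> 0" if "x \<in> D" for x
    using p_le[OF zero, of "- x"] that le_funD[OF f(2), of "- x"] f_neg[of x] s0 by simp
  ultimately show ?thesis using f(1) by blast
qed

section \<open>Extension of completely positive forms\<close>

abbreviation "lookup \<equiv> Poly_Mapping.lookup"
abbreviation "keys \<equiv> Poly_Mapping.keys"
abbreviation "single \<equiv> Poly_Mapping.single"

instantiation poly_mapping :: (type, real_vector) real_vector
begin

definition scaleR_poly_mapping :: "real \<Rightarrow> ('a \<Rightarrow>\<^sub>0 'b) \<Rightarrow> ('a \<Rightarrow>\<^sub>0 'b)" where
  "scaleR_poly_mapping r = Poly_Mapping.map (scaleR r)"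

lemma lookup_scaleR [simp]: "lookup (r *\<^sub>R \<Phi>) k = r *\<^sub>R lookup \<Phi> k"
  by (simp add: scaleR_poly_mapping_def map.rep_eq when_def)

instance
  by intro_classes (auto intro!: poly_mapping_eqI simp: lookup_add algebra_simps)

end

lemma single_scaleR: "single k (r *\<^sub>R x) = r *\<^sub>R single k x"
  by (rule poly_mapping_eqI) (simp add: lookup_single when_def)

lemma poly_mapping_eq_sum_single:
  "\<Phi> = (\<Sum>k\<in>keys \<Phi>. single k (lookup \<Phi> k))"
proof (rule poly_mapping_eqI)
  fix k
  show "lookup \<Phi> k = lookup (\<Sum>k\<in>keys \<Phi>. single k (lookup \<Phi> k)) k"
    by (simp add: lookup_sum lookup_single when_def in_keys_iff)
qed

lemma star_diff: "star (x - y :: 'a::cstar_algebra) = star x - star y"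
  by (simp add: star_add star_minus flip: add_uminus_conv_diff)

lemma scaleC_zero_left [simp]: "0 *\<^sub>C (x::'a::complex_vector) = 0"
  using scaleC_add_left[of 0 0 x] by simp

lemma scaleC_minus_left: "(- c) *\<^sub>C (x::'a::complex_vector) = - (c *\<^sub>C x)"
  using scaleC_add_left[of "- c" c x] by (simp add: eq_neg_iff_add_eq_0)

lemma scaleC_Re_Im:
  "c *\<^sub>C (x::'a::complex_normed_vector) = Re c *\<^sub>R x + Im c *\<^sub>R (\<i> *\<^sub>C x)"
proof -
  have "c *\<^sub>C x = (of_real (Re c) + of_real (Im c) * \<i>) *\<^sub>C x"
    by (rule arg_cong[where f = "\<lambda>z. z *\<^sub>C x"]) (simp add: complex_eq_iff)
  thus ?thesis by (simp only: scaleC_add_left scaleR_scaleC scaleC_scaleC)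
qed

lemma operator_systemD:
  assumes "operator_system (S :: 'a::cstar_algebra set)"
  shows "0 \<in> S" "a \<in> S \<Longrightarrow> b \<in> S \<Longrightarrow> a + b \<in> S" "a \<in> S \<Longrightarrow> c *\<^sub>C a \<in> S"
    "1 \<in> S" "a \<in> S \<Longrightarrow> star a \<in> S" "a \<in> S \<Longrightarrow> r *\<^sub>R a \<in> S"
proof -
  interpret vector_space "scaleC :: complex \<Rightarrow> 'a \<Rightarrow> 'a" by (rule vector_space_scaleC)
  show "0 \<in> S" "a \<in> S \<Longrightarrow> b \<in> S \<Longrightarrow> a + b \<in> S" "a \<in> S \<Longrightarrow> c *\<^sub>C a \<in> S"
    "1 \<in> S" "a \<in> S \<Longrightarrow> star a \<in> S" "a \<in> S \<Longrightarrow> r *\<^sub>R a \<in> S"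
    using assms
    by (auto simp: operator_system_def scaleR_scaleC subspace_0 subspace_add subspace_scale)
qed

text \<open>Positivity is asked of Gram matrices with a single row \<open>b\<close>; those with
  several rows follow by additivity, since every element of the algebra is an admissible
  argument.\<close>

definition cp_form :: "('a::cstar_algebra \<Rightarrow> 'g \<Rightarrow> 'g \<Rightarrow> complex) \<Rightarrow> bool" where
  "cp_form \<sigma> \<longleftrightarrow>
     (\<forall>a b g h. \<sigma> (a + b) g h = \<sigma> a g h + \<sigma> b g h) \<and>
     (\<forall>c a g h. \<sigma> (c *\<^sub>C a) g h = c * \<sigma> a g h) \<and>
     (\<forall>T b. finite T \<longrightarrow> 0 \<le> (\<Sum>g\<in>T. \<Sum>h\<in>T. \<sigma> (star (b g) * b h) g h))"

section \<open>The pairing with a form and the cone of matrices with Gram Hermitian part\<close>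

definition pairing :: "('a::zero \<Rightarrow> 'g \<Rightarrow> 'g \<Rightarrow> complex) \<Rightarrow> ('g \<times> 'g \<Rightarrow>\<^sub>0 'a) \<Rightarrow> complex" where
  "pairing s \<Phi> = (\<Sum>k\<in>keys \<Phi>. s (lookup \<Phi> k) (fst k) (snd k))"

lemma pairing_superset:
  assumes "\<And>g h. s 0 g h = 0" and "finite K" and "keys \<Phi> \<subseteq> K"
  shows "pairing s \<Phi> = (\<Sum>k\<in>K. s (lookup \<Phi> k) (fst k) (snd k))"
  unfolding pairing_def by (rule sum.mono_neutral_left) (use assms in \<open>auto simp: in_keys_iff\<close>)

text \<open>The anti-Hermitian matrices belong to this cone, so a functional that is nonnegative on it
  vanishes on them.\<close>

definition gram_cone :: "('g \<times> 'g \<Rightarrow>\<^sub>0 'a::cstar_algebra) set" where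
  "gram_cone = {\<Phi>. \<exists>(p::nat) v. \<forall>g h.
     lookup \<Phi> (g, h) + star (lookup \<Phi> (h, g)) = (\<Sum>r<p. star (v r g) * v r h)}"

lemma gram_coneI:
  "(\<And>g h. lookup \<Phi> (g, h) + star (lookup \<Phi> (h, g)) = (\<Sum>r<(p::nat). star (v r g) * v r h)) \<Longrightarrow>
    \<Phi> \<in> gram_cone"
  by (auto simp: gram_cone_def)

lemma gram_cone_add:
  assumes "\<Phi> \<in> gram_cone" and "\<Psi> \<in> gram_cone"
  shows "\<Phi> + \<Psi> \<in> gram_cone"
proof -
  obtain p v where v: "\<And>g h. lookup \<Phi> (g, h) + star (lookup \<Phi> (h, g)) = (\<Sum>r<(p::nat). star (v r g) * v r h)"
    using assms(1) by (auto simp: gram_cone_def)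
  obtain q w where w: "\<And>g h. lookup \<Psi> (g, h) + star (lookup \<Psi> (h, g)) = (\<Sum>r<(q::nat). star (w r g) * w r h)"
    using assms(2) by (auto simp: gram_cone_def)
  define u where "u r = (if r < p then v r else w (r - p))" for r
  show ?thesis
  proof (rule gram_coneI)
    fix g h
    have "(\<Sum>r<p + q. star (u r g) * u r h) =
        (\<Sum>r<p. star (u r g) * u r h) + (\<Sum>r<q. star (u (p + r) g) * u (p + r) h)"
      by (induction q) (simp_all add: add.assoc)
    also have "\<dots> = (\<Sum>r<p. star (v r g) * v r h) + (\<Sum>r<q. star (w r g) * w r h)"
      by (simp add: u_def)
    finally show "lookup (\<Phi> + \<Psi>) (g, h) + star (lookup (\<Phi> + \<Psi>) (h, g)) = (\<Sum>r<p + q. star (u r g) * u r h)"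
      by (simp add: lookup_add star_add ac_simps flip: v w)
  qed
qed

lemma gram_cone_scaleR:
  assumes "r \<ge> 0" and "\<Phi> \<in> gram_cone"
  shows "r *\<^sub>R \<Phi> \<in> gram_cone"
proof -
  obtain p v where v: "\<And>g h. lookup \<Phi> (g, h) + star (lookup \<Phi> (h, g)) = (\<Sum>r<(p::nat). star (v r g) * v r h)"
    using assms(2) by (auto simp: gram_cone_def)
  show ?thesis
  proof (rule gram_coneI)
    fix g h
    have "lookup (r *\<^sub>R \<Phi>) (g, h) + star (lookup (r *\<^sub>R \<Phi>) (h, g)) =
        r *\<^sub>R (lookup \<Phi> (g, h) + star (lookup \<Phi> (h, g)))"
      by (simp add: star_scaleR scaleR_right_distrib)
    also have "\<dots> = (\<Sum>i<p. star (sqrt r *\<^sub>R v i g) * (sqrt r *\<^sub>R v i h))"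
      using assms(1) by (simp add: v star_scaleR scaleR_right.sum)
    finally show "lookup (r *\<^sub>R \<Phi>) (g, h) + star (lookup (r *\<^sub>R \<Phi>) (h, g)) = \<dots>" .
  qed
qed

text \<open>Archimedean property: with \<open>a\<^sup>*a + d\<^sup>*d = c\<close> the matrix
  \<open>[1, -a; -a\<^sup>*, c]\<close> is the Gram matrix of the rows \<open>(1, -a)\<close> and \<open>(0, d)\<close>.\<close>

lemma gram_cone_dominates_single:
  fixes a :: "'a::cstar_algebra"
  shows "\<exists>c. (1/2) *\<^sub>R single (g, g) 1 + c *\<^sub>R single (h, h) 1
    - single (g, h) a \<in> gram_cone"
proof -
  obtain c d where d: "star a * a + star d * d = c *\<^sub>R 1"
    using star_mult_self_le_scaleR_one[of a] by blast
  define v where "v r x = (if r = 0 then (1 when x = g) - (a when x = h) else (d when x = h))"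
    for r :: nat and x
  \<comment> \<open>Membership in the cone tests a matrix plus its adjoint, which doubles the
    diagonal entries; hence the weights \<open>1/2\<close> and \<open>c/2\<close>.\<close>
  have half: "(1/2) *\<^sub>R z + (1/2) *\<^sub>R z = z" "(c/2) *\<^sub>R z + (c/2) *\<^sub>R z = c *\<^sub>R z" for z :: 'a
    by (simp_all flip: scaleR_left_distrib)
  have "(1/2) *\<^sub>R single (g, g) 1 + (c/2) *\<^sub>R single (h, h) 1
      - single (g, h) a \<in> gram_cone"
  proof (rule gram_coneI)
    fix x y
    have lhs: "lookup ((1/2) *\<^sub>R single (g, g) 1 + (c/2) *\<^sub>R single (h, h) 1
        - single (g, h) a) (x, y)
      + star (lookup ((1/2) *\<^sub>R single (g, g) 1 + (c/2) *\<^sub>R single (h, h) 1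
        - single (g, h) a) (y, x))
      = (1 when x = g \<and> y = g) + (c *\<^sub>R 1 when x = h \<and> y = h)
        - (a when x = g \<and> y = h) - (star a when x = h \<and> y = g)"
      using half[of 1]
      by (cases "x = g"; cases "y = g"; cases "x = h"; cases "y = h")
         (simp_all add: lookup_add lookup_minus lookup_single star_add star_scaleR
           star_diff star_minus algebra_simps)
    have "(\<Sum>r<2. star (v r x) * v r y) = star (v 0 x) * v 0 y + star (v 1 x) * v 1 y"
      by (simp add: numeral_2_eq_2)
    also have "\<dots> = (1 when x = g \<and> y = g) + (c *\<^sub>R 1 when x = h \<and> y = h)
        - (a when x = g \<and> y = h) - (star a when x = h \<and> y = g)"
      unfolding d[symmetric]
      by (cases "x = g"; cases "y = g"; cases "x = h"; cases "y = h")
         (simp_all add: v_def star_diff star_minus algebra_simps)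
    finally show "lookup ((1/2) *\<^sub>R single (g, g) 1 + (c/2) *\<^sub>R single (h, h) 1
        - single (g, h) a) (x, y)
      + star (lookup ((1/2) *\<^sub>R single (g, g) 1 + (c/2) *\<^sub>R single (h, h) 1
        - single (g, h) a) (y, x)) = (\<Sum>r<2. star (v r x) * v r y)"
      unfolding lhs by simp
  qed
  thus ?thesis by blast
qed

text \<open>Every single entry is dominated by a diagonal matrix with real multiples of
  \<open>1\<close>, which is a matrix over \<open>S\<close>; the cone is closed under sums, so the
  entries of the support can be treated one by one.\<close>

lemma gram_cone_dominated:
  assumes S: "operator_system S"
  shows "\<exists>m. (\<forall>k. lookup m k \<in> S) \<and> m - \<Phi> \<in> gram_cone"
proof -
  have "\<exists>m. (\<forall>k. lookup m k \<in> S) \<and> m - (\<Sum>k\<in>K. single k (lookup \<Phi> k)) \<in> gram_cone"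
    if "finite K" for K
    using that
  proof induction
    case empty
    have "(0 :: 'b \<times> 'b \<Rightarrow>\<^sub>0 'a) \<in> gram_cone" by (rule gram_coneI[where p = 0]) simp
    thus ?case using operator_systemD[OF S] by (intro exI[of _ 0]) simp
  next
    case (insert k K)
    obtain m where m: "\<forall>k. lookup m k \<in> S" "m - (\<Sum>k\<in>K. single k (lookup \<Phi> k)) \<in> gram_cone"
      using insert.IH by blast
    obtain g h where k: "k = (g, h)" by (cases k)
    obtain c where c: "(1/2) *\<^sub>R single (g, g) 1 + c *\<^sub>R single (h, h) 1
        - single (g, h) (lookup \<Phi> k) \<in> gram_cone" (is "?n - _ \<in> _")
      using gram_cone_dominates_single[of g h "lookup \<Phi> k"] by auto
    have "\<forall>k. lookup ?n k \<in> S"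
      using operator_systemD[OF S] by (auto simp: lookup_add lookup_single when_def)
    hence "\<forall>k. lookup (m + ?n) k \<in> S" using m(1) operator_systemD[OF S] by (simp add: lookup_add)
    moreover have "m + ?n - (\<Sum>k\<in>insert k K. single k (lookup \<Phi> k)) \<in> gram_cone"
      using gram_cone_add[OF m(2) c] insert.hyps by (simp add: k algebra_simps)
    ultimately show ?case by blast
  qed
  from this[OF finite_keys[of \<Phi>]] show ?thesis by (simp flip: poly_mapping_eq_sum_single)
qed

text \<open>Here positivity must be assumed for Gram matrices with several rows: the sum over
  \<open>r\<close> may have all entries in \<open>S\<close> while its single terms do not, so it
  cannot be split.\<close>

locale positive_form =
  fixes S :: "'a::cstar_algebra set" and s :: "'a \<Rightarrow> 'g \<Rightarrow> 'g \<Rightarrow> complex"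
  assumes S: "operator_system S"
    and add: "\<And>a b g h. a \<in> S \<Longrightarrow> b \<in> S \<Longrightarrow> s (a + b) g h = s a g h + s b g h"
    and scale: "\<And>c a g h. a \<in> S \<Longrightarrow> s (c *\<^sub>C a) g h = c * s a g h"
    and pos: "\<And>T (p::nat) (v :: nat \<Rightarrow> 'g \<Rightarrow> 'a). finite T \<Longrightarrow>
      (\<And>g h. g \<in> T \<Longrightarrow> h \<in> T \<Longrightarrow> (\<Sum>r<p. star (v r g) * v r h) \<in> S) \<Longrightarrow>
      0 \<le> (\<Sum>g\<in>T. \<Sum>h\<in>T. s (\<Sum>r<p. star (v r g) * v r h) g h)"
begin

lemmas SD = operator_systemD[OF S]

lemma form_zero: "s 0 g h = 0"
  using scale[OF SD(1), of 0 g h] by simp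

text \<open>The rows \<open>(1, b)\<close> and \<open>(0, d)\<close> have the Gram matrix
  \<open>[1, b; star b, c]\<close>, whose entries lie in \<open>S\<close> even if \<open>d\<close>
  does not. Its value is real, and so are the diagonal terms, so
  \<open>s b g h + s (star b) h g\<close> is real. Taking \<open>a\<close> and
  \<open>\<i> *\<^sub>C a\<close> for \<open>b\<close> compares imaginary and real parts.\<close>

lemma form_hermitian:
  assumes a: "a \<in> S"
  shows "s (star a) h g = cnj (s a g h)"
proof -
  have one: "Im (s 1 g g) = 0" for g
    using pos[where T = "{g}" and p = 1 and v = "\<lambda>_ _. 1"] SD(4) by (simp add: less_eq_complex_def)
  have key: "Im (s b g h + s (star b) h g) = 0" if b: "b \<in> S" for b
  proof -
    obtain c d where d: "star b * b + star d * d = c *\<^sub>R 1"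
      using star_mult_self_le_scaleR_one[of b] by blast
    have sc: "s (c *\<^sub>R 1) h h = c * s 1 h h" using scale[OF SD(4)] by (simp add: scaleR_scaleC)
    define v where "v r x = (if r = 0 then (1 when x = g) + (b when x = h) else (d when x = h))"
      for r :: nat and x
    have P: "(\<Sum>r<2. star (v r x) * v r y) = (1 when x = g \<and> y = g) + (c *\<^sub>R 1 when x = h \<and> y = h)
        + (b when x = g \<and> y = h) + (star b when x = h \<and> y = g)" for x y
      unfolding d[symmetric]
      by (auto simp: numeral_2_eq_2 v_def when_def star_add algebra_simps)
    have "(\<Sum>r<2. star (v r x) * v r y) \<in> S" for x y
      unfolding P using SD b by (auto simp: when_def)
    hence "0 \<le> (\<Sum>x\<in>{g,h}. \<Sum>y\<in>{g,h}. s (\<Sum>r<2. star (v r x) * v r y) x y)"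
      by (intro pos) auto
    also have "(\<Sum>x\<in>{g,h}. \<Sum>y\<in>{g,h}. s (\<Sum>r<2. star (v r x) * v r y) x y) =
        s 1 g g + s (c *\<^sub>R 1) h h + s b g h + s (star b) h g"
      unfolding P using SD b
      by (cases "g = h") (auto simp: add)
    finally show ?thesis using one[of g] one[of h] sc by (simp add: less_eq_complex_def)
  qed
  have "Im (s (\<i> *\<^sub>C a) g h + s (star (\<i> *\<^sub>C a)) h g) = 0" using key SD a by blast
  hence "Re (s a g h) = Re (s (star a) h g)" using a SD by (simp add: star_scaleC scale)
  with key[OF a] show ?thesis by (simp add: complex_eq_iff)
qed

lemma pairing_add:
  assumes "\<And>k. lookup \<Phi> k \<in> S" and "\<And>k. lookup \<Psi> k \<in> S"
  shows "pairing s (\<Phi> + \<Psi>) = pairing s \<Phi> + pairing s \<Psi>"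
proof -
  let ?K = "keys \<Phi> \<union> keys \<Psi>"
  have sup: "pairing s \<Theta> = (\<Sum>k\<in>?K. s (lookup \<Theta> k) (fst k) (snd k))" if "keys \<Theta> \<subseteq> ?K" for \<Theta>
    using that by (intro pairing_superset form_zero) auto
  have "pairing s (\<Phi> + \<Psi>) = (\<Sum>k\<in>?K. s (lookup (\<Phi> + \<Psi>) k) (fst k) (snd k))"
    by (rule sup) (rule keys_add)
  also have "\<dots> = (\<Sum>k\<in>?K. s (lookup \<Phi> k) (fst k) (snd k) + s (lookup \<Psi> k) (fst k) (snd k))"
    by (simp add: lookup_add add[OF assms])
  also have "\<dots> = pairing s \<Phi> + pairing s \<Psi>"
    by (simp add: sum.distrib sup)
  finally show ?thesis .
qed

lemma pairing_scaleR:
  assumes "\<And>k. lookup \<Phi> k \<in> S"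
  shows "pairing s (r *\<^sub>R \<Phi>) = r * pairing s \<Phi>"
proof -
  have "pairing s (r *\<^sub>R \<Phi>) = (\<Sum>k\<in>keys \<Phi>. s (lookup (r *\<^sub>R \<Phi>) k) (fst k) (snd k))"
    by (rule pairing_superset[of s, OF form_zero]) (auto simp: in_keys_iff)
  thus ?thesis by (simp add: pairing_def sum_distrib_left scaleR_scaleC scale[OF assms])
qed

lemma pairing_single: "pairing s (single (g, h) a) = s a g h"
  by (subst pairing_superset[of s "{(g, h)}"]) (auto simp: form_zero)

text \<open>The pairing of the adjoint matrix is the conjugate, so the value on the Gram matrix
  \<open>\<Phi>\<close> plus adjoint is twice the real part of
  \<open>pairing s \<Phi>\<close>.\<close>

lemma pairing_nonneg:
  assumes S': "\<And>k. lookup \<Phi> k \<in> S" and \<Phi>: "\<Phi> \<in> gram_cone"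
  shows "0 \<le> Re (pairing s \<Phi>)"
proof -
  obtain p v where v: "\<And>g h. lookup \<Phi> (g, h) + star (lookup \<Phi> (h, g)) = (\<Sum>r<(p::nat). star (v r g) * v r h)"
    using \<Phi> by (auto simp: gram_cone_def)
  define T where "T = fst ` keys \<Phi> \<union> snd ` keys \<Phi>"
  have T: "finite T" "keys \<Phi> \<subseteq> T \<times> T" by (auto simp: T_def intro: rev_image_eqI)
  have pair: "pairing s \<Phi> = (\<Sum>g\<in>T. \<Sum>h\<in>T. s (lookup \<Phi> (g, h)) g h)"
    using pairing_superset[of s, OF form_zero _ T(2)] T(1) by (simp add: sum.cartesian_product case_prod_beta)
  have gram_S: "(\<Sum>r<p. star (v r g) * v r h) \<in> S" for g h
    unfolding v[symmetric] by (intro SD(2) SD(5) S')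
  have gram_s: "s (\<Sum>r<p. star (v r g) * v r h) g h = s (lookup \<Phi> (g, h)) g h + cnj (s (lookup \<Phi> (h, g)) h g)" for g h
    unfolding v[symmetric] by (simp only: add[OF S' SD(5)[OF S']] form_hermitian[OF S'])
  have "0 \<le> (\<Sum>g\<in>T. \<Sum>h\<in>T. s (\<Sum>r<p. star (v r g) * v r h) g h)"
    by (intro pos T(1) gram_S)
  also have "\<dots> = pairing s \<Phi> + (\<Sum>g\<in>T. \<Sum>h\<in>T. cnj (s (lookup \<Phi> (h, g)) h g))"
    unfolding pair gram_s by (simp only: sum.distrib)
  also have "(\<Sum>g\<in>T. \<Sum>h\<in>T. cnj (s (lookup \<Phi> (h, g)) h g)) = cnj (pairing s \<Phi>)"
    unfolding pair cnj_sum by (rule sum.swap)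
  finally show ?thesis by (simp add: less_eq_complex_def)
qed

end

text \<open>The usual reconstruction of a complex-linear functional \<open>F\<close> from its real
  part \<open>f\<close>: \<open>F a = f a - \<i> * f (\<i> a)\<close>.\<close>

definition form_of_functional :: "(('g \<times> 'g \<Rightarrow>\<^sub>0 'a::cstar_algebra) \<Rightarrow> real) \<Rightarrow> 'a \<Rightarrow> 'g \<Rightarrow> 'g \<Rightarrow> complex" where
  "form_of_functional f a g h = Complex (f (single (g, h) a)) (- f (single (g, h) (\<i> *\<^sub>C a)))"

lemma form_of_functional_add:
  "linear f \<Longrightarrow> form_of_functional f (a + b) g h = form_of_functional f a g h + form_of_functional f b g h"
  by (simp add: form_of_functional_def single_add linear_add scaleC_add_right complex_eq_iff)

lemma form_of_functional_scaleC:
  assumes f: "linear f"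
  shows "form_of_functional f (c *\<^sub>C a) g h = c * form_of_functional f a g h"
proof -
  have F: "f (single k (x + y)) = f (single k x) + f (single k y)"
    "f (single k (r *\<^sub>R x)) = r * f (single k x)" "f (single k (- x)) = - f (single k x)" for k x y r
    by (simp_all add: single_add single_scaleR single_uminus linear_add[OF f] linear_cmul[OF f] linear_neg[OF f])
  have "\<i> *\<^sub>C \<i> *\<^sub>C a = - a"
    by (simp add: scaleC_scaleC scaleC_minus_left scaleC_one)
  moreover have "\<i> *\<^sub>C c *\<^sub>C a = c *\<^sub>C \<i> *\<^sub>C a" by (simp add: scaleC_scaleC mult.commute)
  ultimately have "c *\<^sub>C a = Re c *\<^sub>R a + Im c *\<^sub>R (\<i> *\<^sub>C a)"
    "\<i> *\<^sub>C c *\<^sub>C a = Re c *\<^sub>R (\<i> *\<^sub>C a) + Im c *\<^sub>R (- a)"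
    using scaleC_Re_Im[of c a] scaleC_Re_Im[of c "\<i> *\<^sub>C a"] by simp_all
  thus ?thesis
    unfolding form_of_functional_def by (simp only: F) (simp add: complex_eq_iff)
qed

text \<open>Let \<open>\<Phi> c\<close> be \<open>c\<close> times the Gram matrix of
  \<open>b\<close>. The real part of the sum is \<open>f (\<Phi> 1)\<close>, and
  \<open>\<Phi> 1\<close> plus its adjoint is the Gram matrix of the row \<open>sqrt 2\<close> times
  \<open>b\<close>. The imaginary part is \<open>- f (\<Phi> \<i>)\<close>; both
  \<open>\<Phi> \<i>\<close> and its negative are anti-Hermitian, so they lie in the cone with no
  rows at all and \<open>f\<close> vanishes there.\<close>

lemma form_of_functional_positive:
  fixes f :: "('g \<times> 'g \<Rightarrow>\<^sub>0 'a::cstar_algebra) \<Rightarrow> real"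
  assumes f: "linear f" and nonneg: "\<And>\<Phi>. \<Phi> \<in> gram_cone \<Longrightarrow> 0 \<le> f \<Phi>" and T: "finite T"
  shows "0 \<le> (\<Sum>g\<in>T. \<Sum>h\<in>T. form_of_functional f (star (b g) * b h) g h)"
proof -
  define \<Phi> where "\<Phi> c = (\<Sum>g\<in>T. \<Sum>h\<in>T. single (g, h) (c *\<^sub>C (star (b g) * b h)))" for c
  have look: "lookup (\<Phi> c) (x, y) = (if x \<in> T \<and> y \<in> T then c *\<^sub>C (star (b x) * b y) else 0)" for c x y
  proof -
    have "lookup (\<Phi> c) (x, y) = (\<Sum>g\<in>T. \<Sum>h\<in>T. if h = y then if g = x then c *\<^sub>C (star (b x) * b y) else 0 else 0)"
      unfolding \<Phi>_def lookup_sum by (intro sum.cong refl) (auto simp: lookup_single when_def)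
    thus ?thesis using T by (cases "y \<in> T") simp_all
  qed
  have f\<Phi>: "f (\<Phi> c) = (\<Sum>g\<in>T. \<Sum>h\<in>T. f (single (g, h) (c *\<^sub>C (star (b g) * b h))))" for c
    by (simp add: \<Phi>_def linear_sum[OF f])
  have "\<Phi> 1 \<in> gram_cone"
  proof (rule gram_coneI)
    fix g h
    show "lookup (\<Phi> 1) (g, h) + star (lookup (\<Phi> 1) (h, g)) =
        (\<Sum>r<Suc 0. star (sqrt 2 *\<^sub>R (if g \<in> T then b g else 0)) * (sqrt 2 *\<^sub>R (if h \<in> T then b h else 0)))"
      by (auto simp: look star_scaleR scaleC_one star_mult star_star scaleR_2)
  qed
  moreover have "\<Phi> c \<in> gram_cone" if "Re c = 0" for c
  proof (rule gram_coneI)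
    have "c *\<^sub>C x + cnj c *\<^sub>C x = 0" for x :: 'a
      unfolding scaleC_add_left[symmetric] using that by (simp add: complex_add_cnj scaleC_zero_left)
    thus "lookup (\<Phi> c) (g, h) + star (lookup (\<Phi> c) (h, g)) = (\<Sum>r<(0::nat). star (undefined r g) * undefined r h)"
      for g h by (auto simp: look star_scaleC star_mult star_star)
  qed
  moreover have "f (\<Phi> (- \<i>)) = - f (\<Phi> \<i>)"
  proof -
    have "(- \<i>) *\<^sub>C x = - (\<i> *\<^sub>C x)" for x :: 'a
      by (rule scaleC_minus_left)
    thus ?thesis by (simp add: f\<Phi> single_uminus linear_neg[OF f] sum_negf)
  qed
  ultimately have "f (\<Phi> 1) \<ge> 0" "f (\<Phi> \<i>) = 0"
    using nonneg[of "\<Phi> 1"] nonneg[of "\<Phi> \<i>"] nonneg[of "\<Phi> (- \<i>)"] by auto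
  thus ?thesis
    by (simp add: less_eq_complex_def form_of_functional_def f\<Phi> scaleC_one sum_negf)
qed

lemma (in positive_form) extension: "\<exists>\<sigma>. cp_form \<sigma> \<and> (\<forall>a\<in>S. \<sigma> a = s a)"
proof -
  define M where "M = {\<Phi> :: 'g \<times> 'g \<Rightarrow>\<^sub>0 'a. \<forall>k. lookup \<Phi> k \<in> S}"
  have M: "lookup \<Phi> k \<in> S" if "\<Phi> \<in> M" for \<Phi> k using that unfolding M_def by blast
  have "\<exists>f. linear f \<and> (\<forall>x\<in>M. f x = Re (pairing s x)) \<and> (\<forall>x\<in>gram_cone. f x \<ge> 0)"
  proof (rule riesz_extension)
    show "0 \<in> M" using SD(1) by (simp add: M_def)
    show "\<exists>m\<in>M. m - x \<in> gram_cone" for x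
      using gram_cone_dominated[OF S, of x] unfolding M_def by blast
    show "\<Phi> + \<Psi> \<in> M" if "\<Phi> \<in> M" "\<Psi> \<in> M" for \<Phi> \<Psi>
      using that SD by (auto simp: M_def lookup_add)
    show "r *\<^sub>R \<Phi> \<in> M" if "\<Phi> \<in> M" for r \<Phi>
      using that SD by (auto simp: M_def)
  qed (simp_all add: M pairing_add pairing_scaleR pairing_nonneg gram_cone_add gram_cone_scaleR)
  then obtain f where f: "linear f" "\<And>x. x \<in> M \<Longrightarrow> f x = Re (pairing s x)" "\<And>x. x \<in> gram_cone \<Longrightarrow> f x \<ge> 0"
    by blast
  have "f (single (g, h) b) = Re (s b g h)" if "b \<in> S" for b g h
    using f(2)[of "single (g, h) b"] that SD
    by (auto simp: M_def lookup_single when_def pairing_single)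
  \<comment> \<open>The real parts at \<open>a\<close> and at \<open>\<i> *\<^sub>C a\<close>, both
    in \<open>S\<close>, determine the complex value.\<close>
  hence "form_of_functional f a = s a" if "a \<in> S" for a
    using that SD by (intro ext) (simp add: form_of_functional_def scale complex_eq_iff)
  moreover have "cp_form (form_of_functional f)"
    using form_of_functional_add[OF f(1)] form_of_functional_scaleC[OF f(1)]
      form_of_functional_positive[OF f(1,3)]
    unfolding cp_form_def by blast
  ultimately show ?thesis by blast
qed

text \<open>The given form is meaningful only for labels in \<open>G\<close>. Setting it to 0
  elsewhere preserves positivity, because a finite set \<open>T\<close> then contributes only
  through \<open>T \<inter> G\<close>, where the matrix is still a Gram matrix.\<close>

theorem kernel_extension:
  fixes s :: "'a::cstar_algebra \<Rightarrow> 'g \<Rightarrow> 'g \<Rightarrow> complex"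
  assumes S: "operator_system S"
    and add: "\<And>a b g h. a \<in> S \<Longrightarrow> b \<in> S \<Longrightarrow> g \<in> G \<Longrightarrow> h \<in> G \<Longrightarrow> s (a + b) g h = s a g h + s b g h"
    and scale: "\<And>c a g h. a \<in> S \<Longrightarrow> g \<in> G \<Longrightarrow> h \<in> G \<Longrightarrow> s (c *\<^sub>C a) g h = c * s a g h"
    and pos: "\<And>T (p::nat) (v :: nat \<Rightarrow> 'g \<Rightarrow> 'a). finite T \<Longrightarrow> T \<subseteq> G \<Longrightarrow>
      (\<And>g h. g \<in> T \<Longrightarrow> h \<in> T \<Longrightarrow> (\<Sum>r<p. star (v r g) * v r h) \<in> S) \<Longrightarrow>
      0 \<le> (\<Sum>g\<in>T. \<Sum>h\<in>T. s (\<Sum>r<p. star (v r g) * v r h) g h)"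
  shows "\<exists>\<sigma>. cp_form \<sigma> \<and> (\<forall>a\<in>S. \<forall>g\<in>G. \<forall>h\<in>G. \<sigma> a g h = s a g h)"
proof -
  define s' where "s' a g h = (if g \<in> G \<and> h \<in> G then s a g h else 0)" for a g h
  interpret positive_form S s'
  proof
    fix T and p :: nat and v :: "nat \<Rightarrow> 'g \<Rightarrow> 'a"
    assume T: "finite T" and P: "\<And>g h. g \<in> T \<Longrightarrow> h \<in> T \<Longrightarrow> (\<Sum>r<p. star (v r g) * v r h) \<in> S"
    have "0 \<le> (\<Sum>g\<in>T \<inter> G. \<Sum>h\<in>T \<inter> G. s (\<Sum>r<p. star (v r g) * v r h) g h)"
      using T P by (intro pos) auto
    also have "\<dots> = (\<Sum>g\<in>T. \<Sum>h\<in>T. s' (\<Sum>r<p. star (v r g) * v r h) g h)"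
      using T by (intro sum.mono_neutral_cong_left) (auto simp: s'_def intro!: sum.mono_neutral_cong_left)
    finally show "0 \<le> \<dots>" .
  qed (use S in \<open>simp_all add: s'_def add scale\<close>)
  show ?thesis using extension by (auto simp: s'_def)
qed

section \<open>Operators from bounded sesquilinear forms\<close>

text \<open>The imaginary parts at \<open>t = 1\<close>, \<open>-1\<close>, \<open>\<i>\<close>
  force \<open>X' = cnj X\<close>. Along \<open>t = r * X\<close> with real \<open>r\<close> the
  expression is a real quadratic polynomial, and its value at the minimum
  \<open>r = - 1 / Re B\<close> is the Cauchy-Schwarz inequality.\<close>

lemma quadratic_form_nonneg:
  fixes A B X X' :: complex
  assumes nonneg: "\<And>t. 0 \<le> A + cnj t * X + t * X' + t * cnj t * B"
  shows "X' = cnj X" and "(cmod X)\<^sup>2 \<le> Re A * Re B" and "0 \<le> Re B"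
proof -
  have A: "Im A = 0" "Re A \<ge> 0" using nonneg[of 0] by (simp_all add: less_eq_complex_def)
  have "Im B = 0" "Im (X + X') = 0"
    using nonneg[of 1] nonneg[of "-1"] A by (simp_all add: less_eq_complex_def)
  moreover from this have "Re X = Re X'"
    using nonneg[of \<i>] A by (simp add: less_eq_complex_def)
  ultimately show X': "X' = cnj X" by (simp add: complex_eq_iff)
  have real: "0 \<le> Re A + 2 * r * (cmod X)\<^sup>2 + r\<^sup>2 * (cmod X)\<^sup>2 * Re B" for r :: real
    unfolding cmod_power2 using nonneg[of "of_real r * X"] X'
    by (simp add: less_eq_complex_def algebra_simps power2_eq_square)
  show B: "0 \<le> Re B"
  proof (rule ccontr)
    assume neg: "\<not> 0 \<le> Re B"
    \<comment> \<open>The values at \<open>r\<close> and \<open>- r\<close> add up to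
      \<open>2 * Re A + 2 * r\<^sup>2 * Re B\<close>; this \<open>r\<close> makes that sum equal to
      \<open>-2\<close>.\<close>
    define r where "r = sqrt ((Re A + 1) / - Re B)"
    have r2: "r * r = (Re A + 1) / - Re B" using A neg by (simp add: r_def)
    have "0 \<le> 2 * Re A + 2 * (r * r * Re B)"
      using nonneg[of "of_real r"] nonneg[of "- of_real r"] by (simp add: less_eq_complex_def algebra_simps)
    moreover have "r * r * Re B = - (Re A + 1)" unfolding r2 using neg by (simp add: field_simps)
    ultimately show False by linarith
  qed
  show "(cmod X)\<^sup>2 \<le> Re A * Re B"
  proof (cases "Re B = 0")
    case False
    with B have "Re B > 0" by simp
    with real[of "- 1 / Re B"] show ?thesis by (simp add: field_simps power2_eq_square)
  next
    case True
    have "cmod X = 0"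
    proof (rule ccontr)
      assume "cmod X \<noteq> 0"
      \<comment> \<open>With \<open>Re B = 0\<close> the polynomial is affine in \<open>r\<close>,
        and here it takes the value \<open>-1\<close>.\<close>
      with real[of "- (Re A + 1) / (2 * (cmod X)\<^sup>2)"] True show False by (simp add: field_simps)
    qed
    with True show ?thesis by simp
  qed
qed

section \<open>Inner product rules and the Cauchy-Schwarz inequality\<close>

lemma cinner_add_right: "cinner (x::'a::chilbert_space) (y + z) = cinner x y + cinner x z"
  by (metis cinner_add_left cinner_commute complex_cnj_add)

lemma cinner_scaleC_right: "cinner (x::'a::chilbert_space) (c *\<^sub>C y) = cnj c * cinner x y"
  by (metis cinner_commute cinner_scaleC_left complex_cnj_mult)

lemma cinner_zero [simp]: "cinner (0::'a::chilbert_space) x = 0" "cinner x (0::'a) = 0"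
  using cinner_add_left[of 0 0 x] cinner_add_right[of x 0 0] by simp_all

lemma cinner_diff: "cinner (x - y :: 'a::chilbert_space) z = cinner x z - cinner y z"
  by (metis add_diff_cancel_right' cinner_add_left diff_add_cancel)

lemma cinner_sum_left: "cinner (sum f I :: 'a::chilbert_space) y = (\<Sum>i\<in>I. cinner (f i) y)"
  by (induction I rule: infinite_finite_induct) (simp_all add: cinner_add_left)

lemma cinner_self: "cinner (x::'a::chilbert_space) x = of_real ((norm x)\<^sup>2)"
  using cinner_commute[of x x] cinner_ge_zero[of x]
  by (simp add: norm_eq_sqrt_cinner complex_eq_iff)

lemma cinner_eqI:
  fixes x y :: "'a::chilbert_space"
  assumes "\<And>z. cinner x z = cinner y z"
  shows "x = y"
  using assms[of "x - y"] cinner_eq_zero_iff[of "x - y"] by (simp add: cinner_diff)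

lemma norm_add_scaleC_square:
  "(norm (x + t *\<^sub>C y :: 'a::chilbert_space))\<^sup>2 = (norm x)\<^sup>2 + 2 * Re (t * cinner y x) + (cmod t)\<^sup>2 * (norm y)\<^sup>2"
proof -
  have "complex_of_real ((norm (x + t *\<^sub>C y))\<^sup>2) =
      of_real ((norm x)\<^sup>2) + t * cinner y x + cnj (t * cinner y x) + (t * cnj t) * of_real ((norm y)\<^sup>2)"
    unfolding cinner_self[symmetric] using cinner_commute[of x y]
    by (simp add: cinner_add_left cinner_add_right cinner_scaleC_left cinner_scaleC_right algebra_simps)
  also have "\<dots> = of_real ((norm x)\<^sup>2 + 2 * Re (t * cinner y x) + (cmod t)\<^sup>2 * (norm y)\<^sup>2)"
    by (simp add: complex_eq_iff complex_mult_cnj cmod_power2)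
  finally show ?thesis using of_real_eq_iff by blast
qed

lemma cinner_Cauchy_Schwarz: "cmod (cinner (x::'a::chilbert_space) y) \<le> norm x * norm y"
proof -
  have "0 \<le> of_real ((norm x)\<^sup>2) + cnj t * cinner x y + t * cnj (cinner x y) + t * cnj t * of_real ((norm y)\<^sup>2)" for t
  proof -
    have "Re (of_real ((norm x)\<^sup>2) + cnj t * cinner x y + t * cnj (cinner x y) + t * cnj t * of_real ((norm y)\<^sup>2))
       = (norm (x + t *\<^sub>C y))\<^sup>2"
      unfolding norm_add_scaleC_square using cinner_commute[of y x]
      by (simp add: complex_mult_cnj cmod_power2)
    thus ?thesis by (simp add: less_eq_complex_def complex_mult_cnj)
  qed
  from quadratic_form_nonneg(2)[OF this]
  have "(cmod (cinner x y))\<^sup>2 \<le> (norm x * norm y)\<^sup>2" by (simp add: power_mult_distrib)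
  thus ?thesis by (rule power2_le_imp_le) simp
qed

text \<open>The representing vector minimises \<open>\<parallel>x\<parallel>\<^sup>2 / 2 - Re (\<phi> x)\<close>.\<close>

theorem riesz_representation:
  fixes \<phi> :: "'a::chilbert_space \<Rightarrow> complex"
  assumes add: "\<And>x y. \<phi> (x + y) = \<phi> x + \<phi> y"
    and scale: "\<And>c x. \<phi> (c *\<^sub>C x) = c * \<phi> x"
    and bound: "\<And>x. cmod (\<phi> x) \<le> C * norm x"
  shows "\<exists>z. \<forall>x. cinner x z = \<phi> x"
proof -
  define J where "J x = (norm x)\<^sup>2 / 2 - Re (\<phi> x)" for x
  have J_lower: "- C\<^sup>2 / 2 \<le> J x" for x
  proof -
    have "Re (\<phi> x) \<le> C * norm x" using bound[of x] complex_Re_le_cmod[of "\<phi> x"] by linarith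
    moreover have "0 \<le> (norm x - C)\<^sup>2" by simp
    ultimately show ?thesis by (simp add: J_def power2_diff algebra_simps)
  qed
  define m where "m = Inf (range J)"
  have m_le: "m \<le> J x" for x
    unfolding m_def using J_lower by (intro cInf_lower bdd_belowI[of _ "- C\<^sup>2 / 2"]) auto
  have "\<exists>x. J x < m + 1 / Suc n" for n
    using cInf_lessD[of "range J" "m + 1 / Suc n"] by (auto simp: m_def)
  then obtain X where X: "\<And>n. J (X n) < m + 1 / Suc n" by metis
  have J_add: "J (x + t *\<^sub>C y) = J x + Re (t * (cinner y x - \<phi> y)) + (cmod t)\<^sup>2 * (norm y)\<^sup>2 / 2" for x y t
    unfolding J_def norm_add_scaleC_square by (simp add: add scale field_simps)
  \<comment> \<open>At the midpoint \<open>J\<close> is at least \<open>m\<close>, yet it lies below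
    the mean of \<open>J x\<close> and \<open>J y\<close> by an eighth of the squared distance.
    Hence near-minimisers are close together.\<close>
  have parallelogram: "(norm (x - y))\<^sup>2 \<le> 4 * (J x - m) + 4 * (J y - m)" for x y
  proof -
    define u where "u = y - x"
    have y: "y = x + 1 *\<^sub>C u" by (simp add: u_def scaleC_one)
    define L where "L = Re (cinner u x - \<phi> u)"
    have "J y = J x + L + (norm u)\<^sup>2 / 2"
      by (subst y, subst J_add) (simp add: L_def)
    moreover have "m \<le> J x + L / 2 + (norm u)\<^sup>2 / 8"
      using m_le[of "x + (1/2) *\<^sub>C u"] unfolding J_add
      by (simp add: power2_eq_square norm_divide L_def)
    ultimately have "(norm u)\<^sup>2 \<le> 4 * (J x - m) + 4 * (J y - m)" by (simp add: field_simps)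
    thus ?thesis by (simp add: u_def norm_minus_commute)
  qed
  have "Cauchy X"
  proof (rule CauchyI)
    fix e :: real assume e: "e > 0"
    obtain N where N: "1 / Suc N < e\<^sup>2 / 8" using nat_approx_posE[of "e\<^sup>2 / 8"] e by auto
    have "norm (X k - X l) < e" if "k \<ge> N" "l \<ge> N" for k l
    proof -
      have small: "8 * (J (X i) - m) < e\<^sup>2" if "i \<ge> N" for i
      proof -
        have "1 / real (Suc i) \<le> 1 / Suc N" using that by (intro divide_left_mono) auto
        with X[of i] N have "J (X i) - m < e\<^sup>2 / 8" by linarith
        thus ?thesis by (simp add: field_simps)
      qed
      have "(norm (X k - X l))\<^sup>2 < e\<^sup>2"
        using parallelogram[of "X k" "X l"] small[OF that(1)] small[OF that(2)] by linarith
      thus ?thesis using e by (simp add: power2_less_imp_less)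
    qed
    thus "\<exists>N. \<forall>k\<ge>N. \<forall>l\<ge>N. norm (X k - X l) < e" by blast
  qed
  then obtain z where z: "X \<longlonglongrightarrow> z" using Cauchy_convergent_iff convergent_def by blast
  have "bounded_linear (\<lambda>x. Re (\<phi> x))"
  proof (rule bounded_linear_intro[where K = C])
    show "norm (Re (\<phi> x)) \<le> norm x * C" for x
      using order_trans[OF abs_Re_le_cmod bound, of x] by (simp add: mult.commute)
    show "Re (\<phi> (x + y)) = Re (\<phi> x) + Re (\<phi> y)" for x y by (simp add: add)
    show "Re (\<phi> (r *\<^sub>R x)) = r *\<^sub>R Re (\<phi> x)" for r x by (simp add: scaleR_scaleC scale)
  qed
  note Re_\<phi> = bounded_linear.tendsto[OF this z]
  have "(\<lambda>n. J (X n)) \<longlonglongrightarrow> J z"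
    unfolding J_def
    by (intro tendsto_diff tendsto_divide tendsto_power tendsto_norm z Re_\<phi> tendsto_const) simp
  moreover have "(\<lambda>n. m + 1 / Suc n) \<longlonglongrightarrow> m + 0"
    by (intro tendsto_add tendsto_const LIMSEQ_Suc[OF lim_1_over_n])
  ultimately have "J z \<le> m + 0"
    by (rule LIMSEQ_le) (use X in \<open>auto intro: less_imp_le\<close>)
  hence min: "J z \<le> J x" for x using m_le[of x] by simp
  have "cinner x z = \<phi> x" for x
  proof -
    define w where "w = cinner x z - \<phi> x"
    \<comment> \<open>Twice the increment of \<open>J\<close> from \<open>z\<close> to
      \<open>z + t *\<^sub>C x\<close> is a nonnegative quadratic expression with constant term 0,
      so its linear coefficient \<open>w\<close> vanishes.\<close>
    have "0 \<le> 0 + cnj t * cnj w + t * w + t * cnj t * of_real ((norm x)\<^sup>2)" for t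
      using min[of "z + t *\<^sub>C x"]
      by (simp add: J_add less_eq_complex_def complex_mult_cnj cmod_power2 flip: w_def)
    from quadratic_form_nonneg(2)[OF this] show ?thesis by (simp add: w_def)
  qed
  thus ?thesis by blast
qed

lemma bop_apply_linear:
  fixes T :: "'y::complex_normed_vector bop"
  shows "bop_apply T (x + y) = bop_apply T x + bop_apply T y"
    and "bop_apply T (c *\<^sub>C x) = c *\<^sub>C bop_apply T x"
    and "bop_apply T 0 = 0"
    and "bounded_linear (bop_apply T)"
proof -
  have T: "bounded_linear (bop_apply T)" "\<forall>c x. bop_apply T (c *\<^sub>C x) = c *\<^sub>C bop_apply T x"
    using bop_apply[of T] by auto
  show "bop_apply T (x + y) = bop_apply T x + bop_apply T y" "bop_apply T (c *\<^sub>C x) = c *\<^sub>C bop_apply T x"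
    "bop_apply T 0 = 0" "bounded_linear (bop_apply T)"
    using T linear_add[OF bounded_linear.linear[OF T(1)]] linear_0[OF bounded_linear.linear[OF T(1)]] by auto
qed

lemma bop_eqI:
  fixes T T' :: "'y::chilbert_space bop"
  assumes "\<And>x y. cinner (bop_apply T x) y = cinner (bop_apply T' x) y"
  shows "T = T'"
  by (metis assms bop_apply_inject cinner_eqI ext)

lemma bop_apply_add: "bop_apply (T + T') x = bop_apply T x + bop_apply T' x"
  and bop_apply_scaleC: "bop_apply (c *\<^sub>C T) x = c *\<^sub>C bop_apply T x"
  and bop_apply_zero: "bop_apply 0 x = 0"
  by (transfer; simp)+

lemma bop_apply_sum: "bop_apply (sum f I) x = (\<Sum>i\<in>I. bop_apply (f i) x)"
  by (induction I rule: infinite_finite_induct) (simp_all add: bop_apply_add bop_apply_zero)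

theorem bounded_sesquilinear_form_bop:
  fixes B :: "'y::chilbert_space \<Rightarrow> 'y \<Rightarrow> complex"
  assumes add_left: "\<And>x y z. B (x + y) z = B x z + B y z"
    and scale_left: "\<And>c x z. B (c *\<^sub>C x) z = c * B x z"
    and add_right: "\<And>x y z. B z (x + y) = B z x + B z y"
    and scale_right: "\<And>c x z. B z (c *\<^sub>C x) = cnj c * B z x"
    and bound: "\<And>x y. cmod (B x y) \<le> C * norm x * norm y"
  shows "\<exists>T :: 'y bop. \<forall>x y. cinner (bop_apply T x) y = B x y"
proof -
  have "\<exists>z. \<forall>y. cinner y z = cnj (B x y)" for x
    by (rule riesz_representation[where C = "C * norm x"])
       (use bound in \<open>simp_all add: add_right scale_right\<close>)
  then obtain f where f: "\<And>x y. cinner y (f x) = cnj (B x y)" by metis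
  have f': "cinner (f x) y = B x y" for x y
    by (metis cinner_commute complex_cnj_cnj f)
  have f_scale: "f (c *\<^sub>C x) = c *\<^sub>C f x" for c x
    by (rule cinner_eqI) (simp add: f' scale_left cinner_scaleC_left)
  have "norm (f x) \<le> norm x * C" for x
  proof (cases "norm (f x) = 0")
    \<comment> \<open>The constant \<open>C\<close> comes without a sign; as soon as some
      \<open>x\<close> is nonzero, the bound at \<open>(x, x)\<close> makes it nonnegative.\<close>
    case True
    show ?thesis
    proof (cases "x = 0")
      case False
      hence "0 \<le> C * norm x * norm x" using bound[of x x] norm_ge_zero order_trans by blast
      thus ?thesis using True False by (simp add: zero_le_mult_iff mult.commute)
    qed (use True in simp)
  next
    case False
    have "B x (f x) = of_real ((norm (f x))\<^sup>2)" using f'[of x "f x"] cinner_self[of "f x"] by simp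
    hence "(norm (f x))\<^sup>2 = cmod (B x (f x))" by (simp only: norm_of_real) simp
    also have "\<dots> \<le> C * norm x * norm (f x)" by (rule bound)
    finally show ?thesis using False by (simp add: power2_eq_square mult.commute)
  qed
  hence "bounded_linear f"
    by (intro bounded_linear_intro[where K = C] cinner_eqI)
       (simp_all add: f' add_left cinner_add_left scaleR_scaleC scale_left cinner_scaleC_left)
  hence "bop_apply (Bop f) = f" by (intro Bop_inverse) (simp add: f_scale)
  thus ?thesis using f' by (intro exI[of _ "Bop f"]) simp
qed

section \<open>Inequalities for completely positive forms\<close>

lemma cp_form_add: "cp_form \<sigma> \<Longrightarrow> \<sigma> (a + b) g h = \<sigma> a g h + \<sigma> b g h"
  and cp_form_scaleC: "cp_form \<sigma> \<Longrightarrow> \<sigma> (c *\<^sub>C a) g h = c * \<sigma> a g h"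
  and cp_form_pos: "cp_form \<sigma> \<Longrightarrow> finite T \<Longrightarrow> 0 \<le> (\<Sum>g\<in>T. \<Sum>h\<in>T. \<sigma> (star (v g) * v h) g h)"
  by (auto simp: cp_form_def)

lemma cp_form_zero: "cp_form \<sigma> \<Longrightarrow> \<sigma> 0 g h = 0"
  using cp_form_add[of \<sigma> 0 0] by simp

lemma cp_form_sum: "cp_form \<sigma> \<Longrightarrow> \<sigma> (sum f I) g h = (\<Sum>i\<in>I. \<sigma> (f i) g h)"
  by (induction I rule: infinite_finite_induct) (simp_all add: cp_form_add cp_form_zero)

text \<open>A family may repeat a generator, whereas \<open>cp_form\<close> sums over a set. Adding
  up the entries \<open>b i\<close> that share a generator reduces the one to the other.\<close>

lemma cp_form_pos_family:
  assumes \<sigma>: "cp_form \<sigma>" and I: "finite I"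
  shows "0 \<le> (\<Sum>i\<in>I. \<Sum>j\<in>I. \<sigma> (star (b i) * b j) (g i) (g j))"
proof -
  define F where "F x = {i \<in> I. g i = x}" for x
  have regroup: "sum f I = (\<Sum>x\<in>g ` I. \<Sum>i\<in>F x. f i)" for f :: "_ \<Rightarrow> complex"
    unfolding F_def by (rule sum.image_gen[OF I])
  have "0 \<le> (\<Sum>x\<in>g ` I. \<Sum>y\<in>g ` I. \<sigma> (star (\<Sum>i\<in>F x. b i) * (\<Sum>j\<in>F y. b j)) x y)"
    using I by (intro cp_form_pos[OF \<sigma>]) simp
  also have "\<dots> = (\<Sum>x\<in>g ` I. \<Sum>y\<in>g ` I. \<Sum>i\<in>F x. \<Sum>j\<in>F y. \<sigma> (star (b i) * b j) (g i) (g j))"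
    by (intro sum.cong refl) (simp add: star_sum sum_product cp_form_sum[OF \<sigma>] F_def)
  also have "\<dots> = (\<Sum>x\<in>g ` I. \<Sum>i\<in>F x. \<Sum>y\<in>g ` I. \<Sum>j\<in>F y. \<sigma> (star (b i) * b j) (g i) (g j))"
    by (intro sum.cong refl sum.swap)
  also have "\<dots> = (\<Sum>i\<in>I. \<Sum>j\<in>I. \<sigma> (star (b i) * b j) (g i) (g j))"
    by (simp only: regroup[symmetric])
  finally show ?thesis .
qed

text \<open>Positivity for the row with entry \<open>a\<close> at \<open>h\<close> and scalar
  entries \<open>t * w i\<close> at the \<open>g i\<close>, expanded in \<open>t\<close>. The index
  \<open>None\<close> is reserved for \<open>h\<close>, which may coincide with some
  \<open>g i\<close>.\<close>

lemma cp_form_quadratic: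
  assumes \<sigma>: "cp_form \<sigma>" and I: "finite I"
  shows "0 \<le> \<sigma> (star a * a) h h + cnj t * (\<Sum>i\<in>I. cnj (w i) * \<sigma> a (g i) h)
    + t * (\<Sum>i\<in>I. w i * \<sigma> (star a) h (g i)) + t * cnj t * (\<Sum>i\<in>I. \<Sum>j\<in>I. cnj (w i) * w j * \<sigma> 1 (g i) (g j))"
proof -
  define b where "b x = (case x of None \<Rightarrow> a | Some i \<Rightarrow> (t * w i) *\<^sub>C 1)" for x
  define g' where "g' x = (case x of None \<Rightarrow> h | Some i \<Rightarrow> g i)" for x
  have "0 \<le> (\<Sum>x\<in>insert None (Some ` I). \<Sum>y\<in>insert None (Some ` I). \<sigma> (star (b x) * b y) (g' x) (g' y))"
    using I by (intro cp_form_pos_family[OF \<sigma>]) simp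
  also have "\<dots> = \<sigma> (star a * a) h h + (\<Sum>i\<in>I. t * w i * \<sigma> (star a) h (g i))
      + ((\<Sum>i\<in>I. cnj t * cnj (w i) * \<sigma> a (g i) h) + (\<Sum>i\<in>I. \<Sum>j\<in>I. cnj t * cnj (w i) * (t * w j) * \<sigma> 1 (g i) (g j)))"
    using I by (simp add: sum.reindex b_def g'_def star_scaleC mult_scaleC_left mult_scaleC_right
        cp_form_scaleC[OF \<sigma>] sum.distrib mult.assoc scaleC_scaleC) (simp add: mult_ac)
  finally show ?thesis by (simp add: sum_distrib_left mult_ac add_ac)
qed

lemma cp_form_hermitian:
  assumes "cp_form \<sigma>"
  shows "\<sigma> (star a) h g = cnj (\<sigma> a g h)"
  using quadratic_form_nonneg(1)[OF cp_form_quadratic[OF assms, of "{()}" a h _ "\<lambda>_. 1" "\<lambda>_. g"]] by simp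

text \<open>By Cauchy--Schwarz, the null vectors of the form at \<open>1\<close> are null for the form at every
  element. This transfers linearity in \<open>y\<close> and intertwinings from a kernel to its extension.\<close>

lemma cp_form_relation:
  assumes "cp_form \<sigma>" and "finite I"
    and null: "\<And>j. j \<in> I \<Longrightarrow> (\<Sum>i\<in>I. w i * \<sigma> 1 (g i) (g j)) = 0"
  shows "(\<Sum>i\<in>I. w i * \<sigma> a (g i) h) = 0"
proof -
  have "(\<Sum>i\<in>I. \<Sum>j\<in>I. w i * cnj (w j) * \<sigma> 1 (g i) (g j)) = (\<Sum>j\<in>I. cnj (w j) * (\<Sum>i\<in>I. w i * \<sigma> 1 (g i) (g j)))"
    by (subst sum.swap) (simp add: sum_distrib_left mult_ac)
  with null have "(\<Sum>i\<in>I. \<Sum>j\<in>I. w i * cnj (w j) * \<sigma> 1 (g i) (g j)) = 0" by simp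
  with quadratic_form_nonneg(2)[OF cp_form_quadratic[OF assms(1,2), of a h _ "\<lambda>i. cnj (w i)" g]]
  show ?thesis by simp
qed

text \<open>Cauchy-Schwarz gives the factor \<open>\<sigma> (star a * a) h h\<close>, and
  \<open>star a * a + star d * d = c\<close> replaces it by a multiple of
  \<open>\<sigma> 1 h h\<close>. The constant depends on \<open>a\<close> alone, which makes the
  bound uniform in the generators.\<close>

lemma cp_form_bound:
  fixes \<sigma> :: "'a::cstar_algebra \<Rightarrow> 'g \<Rightarrow> 'g \<Rightarrow> complex"
  assumes \<sigma>: "cp_form \<sigma>"
  shows "\<exists>c\<ge>0. \<forall>g h. (cmod (\<sigma> a g h))\<^sup>2 \<le> c * Re (\<sigma> 1 g g) * Re (\<sigma> 1 h h)"
proof -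
  obtain c d where c: "c > 0" and d: "star a * a + star d * d = c *\<^sub>R 1"
    using star_mult_self_le_scaleR_one[of a] by blast
  have "(cmod (\<sigma> a g h))\<^sup>2 \<le> c * Re (\<sigma> 1 g g) * Re (\<sigma> 1 h h)" for g h
  proof -
    note quad = cp_form_quadratic[OF \<sigma>, of "{()}" a h _ "\<lambda>_. 1" "\<lambda>_. g"]
    have 1: "(cmod (\<sigma> a g h))\<^sup>2 \<le> Re (\<sigma> (star a * a) h h) * Re (\<sigma> 1 g g)" "0 \<le> Re (\<sigma> 1 g g)"
      using quadratic_form_nonneg(2,3)[OF quad] by simp_all
    have "\<sigma> (star a * a) h h + \<sigma> (star d * d) h h = c * \<sigma> 1 h h"
      using cp_form_add[OF \<sigma>, of "star a * a" "star d * d" h h] cp_form_scaleC[OF \<sigma>, of c 1 h h]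
      by (simp add: d scaleR_scaleC)
    moreover have "0 \<le> \<sigma> (star d * d) h h"
      using cp_form_pos[OF \<sigma>, of "{h}" "\<lambda>_. d"] by simp
    ultimately have "Re (\<sigma> (star a * a) h h) \<le> c * Re (\<sigma> 1 h h)"
      by (simp add: complex_eq_iff less_eq_complex_def)
    from mult_right_mono[OF this 1(2)] 1(1) show ?thesis by (simp add: mult_ac)
  qed
  with c show ?thesis by (intro exI[of _ c]) simp
qed

section \<open>The form of a completely positive kernel\<close>

lemma locate_offset:
  "i < length ns \<Longrightarrow> r < ns ! i \<Longrightarrow> locate ns (sum_list (take i ns) + r) = (i, r)"
proof (induction ns arbitrary: i)
  case (Cons n ns)
  thus ?case by (cases i) (auto simp: Let_def)
qed simp

lemma offset_less:
  "i < length ns \<Longrightarrow> r < ns ! i \<Longrightarrow> sum_list (take i ns) + r < sum_list (ns :: nat list)"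
proof (induction ns arbitrary: i)
  case (Cons n ns)
  thus ?case by (cases i) auto
qed simp

lemma offset_cases:
  assumes "r < sum_list (ns :: nat list)"
  obtains i r' where "i < length ns" "r' < ns ! i" "r = sum_list (take i ns) + r'"
  using assms
proof (induction ns arbitrary: r thesis)
  case (Cons n ns)
  show thesis
  proof (cases "r < n")
    case True
    thus thesis by (intro Cons.prems(1)[of 0 r]) auto
  next
    case False
    with Cons.prems(2) have "r - n < sum_list ns" by auto
    then obtain i r' where "i < length ns" "r' < ns ! i" "r - n = sum_list (take i ns) + r'"
      using Cons.IH by blast
    thus thesis using False by (intro Cons.prems(1)[of "Suc i" r']) auto
  qed
qed simp

lemma sum_lessThan_add:
  "(\<Sum>c<m + n. f c) = (\<Sum>c<m. f c) + (\<Sum>c<n. f (m + c) :: 'a::comm_monoid_add)" for m n :: nat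
  by (induction n) (simp_all add: add.assoc)

lemma sum_offset:
  "(\<Sum>c<sum_list (ns :: nat list). f c) = (\<Sum>i<length ns. \<Sum>r<ns ! i. f (sum_list (take i ns) + r) :: 'a::comm_monoid_add)"
proof (induction ns arbitrary: f)
  case (Cons n ns)
  have "(\<Sum>c<sum_list (n # ns). f c) = (\<Sum>c<n. f c) + (\<Sum>c<sum_list ns. f (n + c))"
    unfolding sum_list.Cons by (rule sum_lessThan_add)
  also have "(\<Sum>c<sum_list ns. f (n + c)) = (\<Sum>i<length ns. \<Sum>r<ns ! i. f (n + (sum_list (take i ns) + r)))"
    by (rule Cons.IH)
  finally show ?case by (simp add: sum.lessThan_Suc_shift add.assoc del: sum.lessThan_Suc)
qed simp

lemma assemble_carrier [simp]: "assemble ns Q \<in> carrier_mat (sum_list ns) (sum_list ns)"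
  by (simp add: assemble_def)

lemma assemble_index:
  "i < length ns \<Longrightarrow> r < ns ! i \<Longrightarrow> j < length ns \<Longrightarrow> c < ns ! j \<Longrightarrow>
    assemble ns Q $$ (sum_list (take i ns) + r, sum_list (take j ns) + c) = Q i j $$ (r, c)"
  by (simp add: assemble_def offset_less locate_offset)

lemma block_carrier [simp]: "block ns P i j \<in> carrier_mat (ns ! i) (ns ! j)"
  by (simp add: block_def)

lemma block_index [simp]:
  "r < ns ! i \<Longrightarrow> c < ns ! j \<Longrightarrow> block ns P i j $$ (r, c) = P $$ (sum_list (take i ns) + r, sum_list (take j ns) + c)"
  by (simp add: block_def)

lemma block_assemble:
  assumes "i < length ns" and "j < length ns" and "Q i j \<in> carrier_mat (ns ! i) (ns ! j)"
  shows "block ns (assemble ns Q) i j = Q i j"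
  using assms by (intro eq_matI) (auto simp: block_def assemble_index)

lemma assemble_singleton: "X \<in> carrier_mat N N \<Longrightarrow> assemble (replicate (Suc 0) N) (\<lambda>_ _. X) = X"
  by (intro eq_matI) (auto simp: assemble_def)

lemma completely_positive_imp_positive:
  assumes \<phi>: "completely_positive S N \<phi>" and P: "P \<in> mats S N N" and pos: "cstar_positive N P"
  shows "op_positive N (\<phi> P)"
proof -
  have "P \<in> carrier_mat N N" "\<phi> P \<in> carrier_mat N N"
    using \<phi> P by (auto simp: completely_positive_def mats_def)
  note eq = this[THEN assemble_singleton]
  have "op_positive (Suc 0 * N) (assemble (replicate (Suc 0) N) (\<lambda>a b. \<phi> ((\<lambda>_ _. P) a b)))"
    using \<phi> unfolding completely_positive_def
  proof (elim conjE, elim allE impE)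
    show "\<forall>a<Suc 0. \<forall>b<Suc 0. (\<lambda>_ _. P) a b \<in> mats S N N" using P by simp
    show "cstar_positive (Suc 0 * N) (assemble (replicate (Suc 0) N) (\<lambda>_ _. P))"
      unfolding eq(1) using pos by simp
  qed
  thus ?thesis unfolding eq(2) by simp
qed

lemma mats_iff: "P \<in> mats X n m \<longleftrightarrow> P \<in> carrier_mat n m \<and> (\<forall>i<n. \<forall>j<m. P $$ (i, j) \<in> X)"
  unfolding mats_def elements_mat_def by fastforce

lemma op_positive_iff:
  "op_positive N T \<longleftrightarrow> T \<in> carrier_mat N N \<and>
    (\<forall>y\<in>carrier_vec N. 0 \<le> (\<Sum>i<N. \<Sum>j<N. cinner (bop_apply (T $$ (i, j)) (y $ j)) (y $ i)))"
  by (auto simp: op_positive_def cinner_sum_left less_eq_complex_def Let_def)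

lemma op_positive_assemble_iff:
  "op_positive (sum_list ns) (assemble ns Q) \<longleftrightarrow>
    (\<forall>y\<in>carrier_vec (sum_list ns). 0 \<le> (\<Sum>i<length ns. \<Sum>r<ns ! i. \<Sum>j<length ns. \<Sum>c<ns ! j.
       cinner (bop_apply (Q i j $$ (r, c)) (y $ (sum_list (take j ns) + c))) (y $ (sum_list (take i ns) + r))))"
  unfolding op_positive_iff sum_offset
  by (simp add: assemble_index)

section \<open>Matrix units and levels of a kernel\<close>

definition elem_mat :: "nat \<Rightarrow> nat \<Rightarrow> nat \<Rightarrow> nat \<Rightarrow> 'a::zero \<Rightarrow> 'a mat" where
  "elem_mat n m k l a = mat n m (\<lambda>(r, c). if r = k \<and> c = l then a else 0)"

lemma elem_mat_carrier [simp]: "elem_mat n m k l a \<in> carrier_mat n m"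
  by (simp add: elem_mat_def)

lemma elem_mat_index [simp]:
  "r < n \<Longrightarrow> c < m \<Longrightarrow> elem_mat n m k l a $$ (r, c) = (if r = k \<and> c = l then a else 0)"
  by (simp add: elem_mat_def)

lemma elem_mat_dim [simp]: "dim_row (elem_mat n m k l a) = n" "dim_col (elem_mat n m k l a) = m"
  by (simp_all add: elem_mat_def)

lemma elem_mat_add: "elem_mat n m k l (a + b) = elem_mat n m k l a + elem_mat n m k l (b :: 'a::monoid_add)"
  by (rule eq_matI) auto

lemma elem_mat_scaleC: "elem_mat n m k l (c *\<^sub>C a) = map_mat (scaleC c) (elem_mat n m k l (a :: 'a::complex_vector))"
  by (rule eq_matI) auto

lemma elem_mat_mats: "operator_system S \<Longrightarrow> a \<in> S \<Longrightarrow> elem_mat n m k l a \<in> mats S n m"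
  using operator_systemD(1) by (auto simp: mats_iff)

text \<open>\<open>P\<close> is built up one entry at a time, with zeros elsewhere, so that all
  intermediate matrices remain over \<open>S\<close>. That the zero matrix has value zero comes from
  scaling by 0.\<close>

lemma linear_on_mats_expand:
  assumes S: "operator_system S" and \<phi>: "linear_on_mats (mats S n m) \<phi>" "\<phi> \<in> mats S n m \<rightarrow> carrier_mat n' m'"
    and P: "P \<in> mats S n m" and ij: "i < n'" "j < m'"
  shows "\<phi> P $$ (i, j) = (\<Sum>k<n. \<Sum>l<m. \<phi> (elem_mat n m k l (P $$ (k, l))) $$ (i, j))"
proof -
  define R where "R T = mat n m (\<lambda>(r, c). if (r, c) \<in> T then P $$ (r, c) else 0)" for T
  have R_mats: "R T \<in> mats S n m" for T
    using P operator_systemD(1)[OF S] by (auto simp: mats_iff R_def)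
  have carr: "\<phi> Q \<in> carrier_mat n' m'" if "Q \<in> mats S n m" for Q using \<phi>(2) that by auto
  have "\<phi> (R T) $$ (i, j) = (\<Sum>(k, l)\<in>T. \<phi> (elem_mat n m k l (P $$ (k, l))) $$ (i, j))"
    if "finite T" "T \<subseteq> {..<n} \<times> {..<m}" for T
    using that
  proof (induction T)
    case empty
    have "\<phi> (map_mat (scaleC 0) (R {})) = map_mat (scaleC 0) (\<phi> (R {}))"
      using \<phi>(1) R_mats unfolding linear_on_mats_def by blast
    moreover have "map_mat (scaleC 0) (R {}) = R {}" by (rule eq_matI) (auto simp: R_def)
    ultimately have "\<phi> (R {}) $$ (i, j) = map_mat (scaleC 0) (\<phi> (R {})) $$ (i, j)" by simp
    thus ?case using carr[OF R_mats[of "{}"]] ij by simp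
  next
    case (insert x T)
    obtain k l where x: "x = (k, l)" by (cases x)
    have kl: "k < n" "l < m" using insert.prems x by auto
    have E: "elem_mat n m k l (P $$ (k, l)) \<in> mats S n m"
      using P kl by (intro elem_mat_mats[OF S]) (auto simp: mats_iff)
    have "R (insert x T) = elem_mat n m k l (P $$ (k, l)) + R T"
      using insert.hyps(2) by (intro eq_matI) (auto simp: R_def x)
    hence "\<phi> (R (insert x T)) = \<phi> (elem_mat n m k l (P $$ (k, l))) + \<phi> (R T)"
      using \<phi>(1) E R_mats unfolding linear_on_mats_def by simp
    thus ?case using insert carr[OF E] carr[OF R_mats[of T]] ij by (simp add: x)
  qed
  from this[of "{..<n} \<times> {..<m}"] have "\<phi> (R ({..<n} \<times> {..<m})) $$ (i, j) =
      (\<Sum>k<n. \<Sum>l<m. \<phi> (elem_mat n m k l (P $$ (k, l))) $$ (i, j))"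
    by (simp add: sum.cartesian_product)
  moreover have "R ({..<n} \<times> {..<m}) = P" using P by (intro eq_matI) (auto simp: R_def mats_iff)
  ultimately show ?thesis by simp
qed

lemma nc_space_dim: "Z \<in> nc_space \<Longrightarrow> Z \<in> carrier_mat (dim_row Z) (dim_row Z) \<and> 0 < dim_row Z"
  by (auto simp: nc_space_def)

lemma graded_level_iff: "\<Omega> \<subseteq> nc_space \<Longrightarrow> Z \<in> graded_level \<Omega> n \<longleftrightarrow> Z \<in> \<Omega> \<and> dim_row Z = n"
  using nc_space_dim by (auto simp: graded_level_def)

lemma nc_kernel_level:
  assumes "\<Omega> \<subseteq> nc_space" and "nc_kernel \<Omega> X K" and "Z \<in> \<Omega>" and "W \<in> \<Omega>"
  shows "K Z W \<in> mats X (dim_row Z) (dim_row W) \<rightarrow> carrier_mat (dim_row Z) (dim_row W)"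
    and "linear_on_mats (mats X (dim_row Z) (dim_row W)) (K Z W)"
  using assms by (auto simp: nc_kernel_def graded_level_iff)

text \<open>The generator \<open>(Z, k, i, y)\<close> stands for the tensor of the \<open>k\<close>-th unit vector with the
  vector whose \<open>i\<close>-th entry is \<open>y\<close>, both of length the size of \<open>Z\<close>.\<close>

type_synonym ('v, 'y) generator = "'v mat \<times> nat \<times> nat \<times> 'y"

definition generators :: "'v mat set \<Rightarrow> ('v, 'y) generator set" where
  "generators \<Omega> = {(Z, k, i, y). Z \<in> \<Omega> \<and> k < dim_row Z \<and> i < dim_row Z}"

text \<open>The vector of the second generator goes into the operator, so the form is conjugate
  linear in the first vector and linear in the second. This matches the position of the star in
  \<open>star (b g) * b h\<close>.\<close>

fun nc_form :: "('v mat \<Rightarrow> 'v mat \<Rightarrow> 'a mat \<Rightarrow> 'y bop mat) \<Rightarrow> 'a::zero \<Rightarrow>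
    ('v, 'y::chilbert_space) generator \<Rightarrow> ('v, 'y) generator \<Rightarrow> complex" where
  "nc_form K a (Z, k, i, y) (W, l, j, y') =
     cinner (bop_apply (K Z W (elem_mat (dim_row Z) (dim_row W) k l a) $$ (i, j)) y') y"

lemma nc_form_linear:
  assumes "\<Omega> \<subseteq> nc_space" and S: "operator_system S" and K: "nc_kernel \<Omega> S K"
    and g: "g \<in> generators \<Omega>" and h: "h \<in> generators \<Omega>" and a: "a \<in> S"
  shows "b \<in> S \<Longrightarrow> nc_form K (a + b) g h = nc_form K a g h + nc_form K b g h"
    and "nc_form K (c *\<^sub>C a) g h = c * nc_form K a g h"
proof -
  obtain Z k i y where g': "g = (Z, k, i, y)" "Z \<in> \<Omega>" "i < dim_row Z"
    using g by (auto simp: generators_def)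
  obtain W l j y' where h': "h = (W, l, j, y')" "W \<in> \<Omega>" "j < dim_row W"
    using h by (auto simp: generators_def)
  note level = nc_kernel_level[OF assms(1) K g'(2) h'(2)]
  let ?E = "elem_mat (dim_row Z) (dim_row W) k l"
  have carr: "K Z W (?E b) \<in> carrier_mat (dim_row Z) (dim_row W)" if "b \<in> S" for b
    using level(1) elem_mat_mats[OF S that] by blast
  have "K Z W (?E (a + b)) = K Z W (?E a) + K Z W (?E b)" if "b \<in> S" for b
    using level(2) elem_mat_mats[OF S a] elem_mat_mats[OF S that]
    unfolding linear_on_mats_def elem_mat_add by blast
  thus "nc_form K (a + b) g h = nc_form K a g h + nc_form K b g h" if "b \<in> S"
    using that carr[OF a] carr[OF that] g'(3) h'(3) by (simp add: g'(1) h'(1) bop_apply_add cinner_add_left)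
  have "K Z W (?E (c *\<^sub>C a)) = map_mat (scaleC c) (K Z W (?E a))"
    using level(2) elem_mat_mats[OF S a] unfolding linear_on_mats_def elem_mat_scaleC by blast
  thus "nc_form K (c *\<^sub>C a) g h = c * nc_form K a g h"
    using carr[OF a] g'(3) h'(3) by (simp add: g'(1) h'(1) bop_apply_scaleC cinner_scaleC_left)
qed

lemma length_le_sum_list: "(\<And>n. n \<in> set ns \<Longrightarrow> 0 < n) \<Longrightarrow> length ns \<le> sum_list (ns :: nat list)"
proof (induction ns)
  case (Cons n ns)
  have "0 < n" "length ns \<le> sum_list ns" using Cons by auto
  thus ?case by simp
qed simp

text \<open>Repeating a point with zero entries makes room for all rows \<open>v r\<close>, so that the Gram matrix
  becomes \<open>B\<^sup>*B\<close> for a square matrix \<open>B\<close>.\<close>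

lemma nc_form_positive:
  fixes K :: "'v::complex_vector mat \<Rightarrow> 'v mat \<Rightarrow> 'a::cstar_algebra mat \<Rightarrow> 'y::chilbert_space bop mat"
  assumes \<Omega>: "\<Omega> \<subseteq> nc_space" and S: "operator_system S" and K: "cp_nc_kernel \<Omega> S K"
    and T: "finite T" "T \<subseteq> generators \<Omega>"
    and gram: "\<And>g h. g \<in> T \<Longrightarrow> h \<in> T \<Longrightarrow> (\<Sum>r<(p::nat). star (v r g) * v r h) \<in> S"
  shows "0 \<le> (\<Sum>g\<in>T. \<Sum>h\<in>T. nc_form K (\<Sum>r<p. star (v r g) * v r h) g h)"
proof (cases "T = {}")
  case False
  obtain ts where ts: "set ts = T" "distinct ts" using finite_distinct_list[OF T(1)] by blast
  define q where "q = length ts"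
  define L where "L = q + p"
  \<comment> \<open>The indices from \<open>q\<close> on are padding; any point of \<open>T\<close>
    serves there, and \<open>hd ts\<close> is available because \<open>T\<close> is
    nonempty.\<close>
  define g where "g \<alpha> = (if \<alpha> < q then ts ! \<alpha> else hd ts)" for \<alpha>
  have g_T: "g \<alpha> \<in> T" for \<alpha> using False ts(1) by (auto simp: g_def q_def)
  define Z where "Z \<alpha> = fst (g \<alpha>)" for \<alpha>
  define \<kappa> where "\<kappa> \<alpha> = fst (snd (g \<alpha>))" for \<alpha>
  define \<iota> where "\<iota> \<alpha> = fst (snd (snd (g \<alpha>)))" for \<alpha>
  define \<eta> where "\<eta> \<alpha> = snd (snd (snd (g \<alpha>)))" for \<alpha>
  have g_eq: "g \<alpha> = (Z \<alpha>, \<kappa> \<alpha>, \<iota> \<alpha>, \<eta> \<alpha>)" for \<alpha> by (simp add: Z_def \<kappa>_def \<iota>_def \<eta>_def)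
  have g_gen: "Z \<alpha> \<in> \<Omega>" "\<kappa> \<alpha> < dim_row (Z \<alpha>)" "\<iota> \<alpha> < dim_row (Z \<alpha>)" for \<alpha>
    using g_T[of \<alpha>] T(2) by (auto simp: g_eq generators_def)
  define Zs where "Zs = map Z [0..<L]"
  define ns where "ns = map dim_row Zs"
  define N where "N = sum_list ns"
  have ns: "length ns = L" "\<And>\<alpha>. \<alpha> < L \<Longrightarrow> ns ! \<alpha> = dim_row (Z \<alpha>)" "\<And>\<alpha>. \<alpha> < L \<Longrightarrow> Zs ! \<alpha> = Z \<alpha>"
    by (auto simp: ns_def Zs_def)
  have "length ns \<le> N" unfolding N_def
    using g_gen(1) \<Omega> nc_space_dim by (intro length_le_sum_list) (auto simp: ns_def Zs_def)
  hence pN: "p \<le> N" by (simp add: ns(1) L_def)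
  define w where "w r \<alpha> = (if \<alpha> < q \<and> r < p then v r (ts ! \<alpha>) else 0)" for r \<alpha>
  define \<Phi> where "\<Phi> \<alpha> \<beta> = (\<Sum>r<p. star (w r \<alpha>) * w r \<beta>)" for \<alpha> \<beta>
  have \<Phi>_lt: "\<Phi> \<alpha> \<beta> = (\<Sum>r<p. star (v r (ts ! \<alpha>)) * v r (ts ! \<beta>))" if "\<alpha> < q" "\<beta> < q" for \<alpha> \<beta>
    using that by (simp add: \<Phi>_def w_def)
  have \<Phi>_ge: "\<Phi> \<alpha> \<beta> = 0" if "\<not> (\<alpha> < q \<and> \<beta> < q)" for \<alpha> \<beta>
    using that by (auto simp: \<Phi>_def w_def intro!: sum.neutral)
  have \<Phi>_S: "\<Phi> \<alpha> \<beta> \<in> S" for \<alpha> \<beta>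
  proof (cases "\<alpha> < q \<and> \<beta> < q")
    case True
    hence "ts ! \<alpha> \<in> T" "ts ! \<beta> \<in> T" using ts(1) by (auto simp: q_def)
    from gram[OF this] True show ?thesis by (simp add: \<Phi>_lt)
  next
    case False
    thus ?thesis using operator_systemD(1)[OF S] by (simp add: \<Phi>_ge)
  qed
  define E where "E \<alpha> \<beta> = elem_mat (ns ! \<alpha>) (ns ! \<beta>) (\<kappa> \<alpha>) (\<kappa> \<beta>) (\<Phi> \<alpha> \<beta>)" for \<alpha> \<beta>
  define P where "P = assemble ns E"
  \<comment> \<open>In the columns of part \<open>\<alpha>\<close>, row \<open>r\<close> of
    \<open>B\<close> has its entry \<open>w r \<alpha>\<close> at position
    \<open>\<kappa> \<alpha>\<close> only. Block \<open>(\<alpha>, \<beta>)\<close> of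
    \<open>star_mat B * B\<close> is thus the matrix unit at
    \<open>(\<kappa> \<alpha>, \<kappa> \<beta>)\<close> times
    \<open>\<Phi> \<alpha> \<beta>\<close>.\<close>
  define B where "B = mat N N (\<lambda>(r, c). let (\<alpha>, c') = locate ns c in if c' = \<kappa> \<alpha> then w r \<alpha> else 0)"
  have B_index: "B $$ (t, sum_list (take \<alpha> ns) + c) = (if c = \<kappa> \<alpha> then w t \<alpha> else 0)"
    if "t < N" "\<alpha> < L" "c < ns ! \<alpha>" for t \<alpha> c
    using that offset_less[of \<alpha> ns c] by (simp add: B_def locate_offset ns(1) N_def)
  have P_eq: "P = star_mat B * B"
  proof (rule eq_matI)
    fix r c assume "r < dim_row (star_mat B * B)" "c < dim_col (star_mat B * B)"
    hence rc: "r < N" "c < N" by (simp_all add: star_mat_def B_def)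
    obtain \<alpha> r' where r': "\<alpha> < L" "r' < ns ! \<alpha>" "r = sum_list (take \<alpha> ns) + r'"
      using offset_cases[of r ns] rc(1) by (auto simp: N_def ns(1))
    obtain \<beta> c' where c': "\<beta> < L" "c' < ns ! \<beta>" "c = sum_list (take \<beta> ns) + c'"
      using offset_cases[of c ns] rc(2) by (auto simp: N_def ns(1))
    have "(star_mat B * B) $$ (r, c) = (\<Sum>t<N. star (B $$ (t, r)) * B $$ (t, c))"
      using rc by (simp add: star_mat_def B_def scalar_prod_def atLeast0LessThan)
    also have "\<dots> = (\<Sum>t<N. if r' = \<kappa> \<alpha> \<and> c' = \<kappa> \<beta> then star (w t \<alpha>) * w t \<beta> else 0)"
      unfolding r'(3) c'(3) using r'(1,2) c'(1,2) by (intro sum.cong refl) (simp add: B_index)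
    also have "\<dots> = (if r' = \<kappa> \<alpha> \<and> c' = \<kappa> \<beta> then \<Phi> \<alpha> \<beta> else 0)"
    proof -
      have "(\<Sum>t<N. star (w t \<alpha>) * w t \<beta>) = \<Phi> \<alpha> \<beta>"
        unfolding \<Phi>_def using pN by (intro sum.mono_neutral_right) (auto simp: w_def)
      thus ?thesis by (cases "r' = \<kappa> \<alpha> \<and> c' = \<kappa> \<beta>") auto
    qed
    also have "\<dots> = P $$ (r, c)"
      using r' c' by (simp add: P_def assemble_index ns(1) E_def)
    finally show "P $$ (r, c) = (star_mat B * B) $$ (r, c)" by simp
  qed (simp_all add: P_def star_mat_def B_def N_def assemble_def)
  have P_carrier: "P \<in> carrier_mat N N" by (simp add: P_def N_def)
  have P_mats: "P \<in> mats S N N"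
    unfolding mats_iff
  proof (intro conjI allI impI P_carrier)
    fix r c assume rc: "r < N" "c < N"
    obtain \<alpha> r' where r': "\<alpha> < L" "r' < ns ! \<alpha>" "r = sum_list (take \<alpha> ns) + r'"
      using offset_cases[of r ns] rc(1) by (auto simp: N_def ns(1))
    obtain \<beta> c' where c': "\<beta> < L" "c' < ns ! \<beta>" "c = sum_list (take \<beta> ns) + c'"
      using offset_cases[of c ns] rc(2) by (auto simp: N_def ns(1))
    show "P $$ (r, c) \<in> S"
      using r' c' \<Phi>_S operator_systemD(1)[OF S] by (simp add: P_def assemble_index ns(1) E_def)
  qed
  define Q where "Q \<alpha> \<beta> = K (Z \<alpha>) (Z \<beta>) (E \<alpha> \<beta>)" for \<alpha> \<beta>
  have "set Zs \<subseteq> \<Omega>" using g_gen(1) by (auto simp: Zs_def)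
  hence cp: "completely_positive S N (\<lambda>P. assemble ns (\<lambda>i j. K (Zs ! i) (Zs ! j) (block ns P i j)))"
    using K unfolding cp_nc_kernel_def Let_def ns_def N_def by blast
  have "B \<in> carrier_mat N N" by (simp add: B_def)
  with P_eq have "cstar_positive N P" unfolding cstar_positive_def by blast
  from completely_positive_imp_positive[OF cp P_mats this]
  have "op_positive (sum_list ns) (assemble ns (\<lambda>i j. K (Zs ! i) (Zs ! j) (block ns P i j)))"
    by (simp only: N_def)
  \<comment> \<open>Part \<open>\<alpha>\<close> of the test vector has
    \<open>\<eta> \<alpha>\<close> at position \<open>\<iota> \<alpha>\<close> and zeros elsewhere,
    so that the quadratic form picks from block \<open>(\<alpha>, \<beta>)\<close> exactly the entry
    used by \<open>nc_form\<close>.\<close>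
  moreover define y where "y = vec N (\<lambda>c. let (\<alpha>, c') = locate ns c in if c' = \<iota> \<alpha> then \<eta> \<alpha> else 0)"
  have "y \<in> carrier_vec (sum_list ns)" by (simp add: y_def N_def)
  ultimately have "0 \<le> (\<Sum>\<alpha><L. \<Sum>r<ns ! \<alpha>. \<Sum>\<beta><L. \<Sum>c<ns ! \<beta>.
       cinner (bop_apply (K (Zs ! \<alpha>) (Zs ! \<beta>) (block ns P \<alpha> \<beta>) $$ (r, c)) (y $ (sum_list (take \<beta> ns) + c)))
         (y $ (sum_list (take \<alpha> ns) + r)))"
    unfolding op_positive_assemble_iff ns(1) by blast
  also have "\<dots> = (\<Sum>\<alpha><L. \<Sum>r<ns ! \<alpha>. \<Sum>\<beta><L. \<Sum>c<ns ! \<beta>.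
       if c = \<iota> \<beta> then if r = \<iota> \<alpha> then cinner (bop_apply (Q \<alpha> \<beta> $$ (r, c)) (\<eta> \<beta>)) (\<eta> \<alpha>) else 0 else 0)"
  proof (intro sum.cong refl)
    fix \<alpha> r \<beta> c assume "\<alpha> \<in> {..<L}" "r \<in> {..<ns ! \<alpha>}" "\<beta> \<in> {..<L}" "c \<in> {..<ns ! \<beta>}"
    hence *: "\<alpha> < L" "r < ns ! \<alpha>" "\<beta> < L" "c < ns ! \<beta>" by auto
    have y: "y $ (sum_list (take \<alpha> ns) + r) = (if r = \<iota> \<alpha> then \<eta> \<alpha> else 0)" if "\<alpha> < L" "r < ns ! \<alpha>" for \<alpha> r
      using that offset_less[of \<alpha> ns r] by (simp add: y_def locate_offset ns(1) N_def)
    have "block ns P \<alpha> \<beta> = E \<alpha> \<beta>"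
      unfolding P_def using * by (intro block_assemble) (simp_all add: ns(1) E_def)
    thus "cinner (bop_apply (K (Zs ! \<alpha>) (Zs ! \<beta>) (block ns P \<alpha> \<beta>) $$ (r, c)) (y $ (sum_list (take \<beta> ns) + c)))
         (y $ (sum_list (take \<alpha> ns) + r)) =
       (if c = \<iota> \<beta> then if r = \<iota> \<alpha> then cinner (bop_apply (Q \<alpha> \<beta> $$ (r, c)) (\<eta> \<beta>)) (\<eta> \<alpha>) else 0 else 0)"
      using * by (simp add: y ns(3) Q_def bop_apply_linear(3))
  qed
  also have "\<dots> = (\<Sum>\<alpha><L. \<Sum>\<beta><L. nc_form K (\<Phi> \<alpha> \<beta>) (g \<alpha>) (g \<beta>))"
  proof (rule sum.cong[OF refl])
    fix \<alpha> assume "\<alpha> \<in> {..<L}"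
    hence \<alpha>: "\<alpha> < L" by simp
    have "(\<Sum>r<ns ! \<alpha>. \<Sum>\<beta><L. \<Sum>c<ns ! \<beta>.
        if c = \<iota> \<beta> then if r = \<iota> \<alpha> then cinner (bop_apply (Q \<alpha> \<beta> $$ (r, c)) (\<eta> \<beta>)) (\<eta> \<alpha>) else 0 else 0)
      = (\<Sum>r<ns ! \<alpha>. \<Sum>\<beta><L.
        if r = \<iota> \<alpha> then cinner (bop_apply (Q \<alpha> \<beta> $$ (r, \<iota> \<beta>)) (\<eta> \<beta>)) (\<eta> \<alpha>) else 0)"
      using g_gen(3) by (intro sum.cong refl) (simp add: ns(2))
    also have "\<dots> = (\<Sum>\<beta><L. \<Sum>r<ns ! \<alpha>.
        if r = \<iota> \<alpha> then cinner (bop_apply (Q \<alpha> \<beta> $$ (r, \<iota> \<beta>)) (\<eta> \<beta>)) (\<eta> \<alpha>) else 0)"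
      by (rule sum.swap)
    also have "\<dots> = (\<Sum>\<beta><L. nc_form K (\<Phi> \<alpha> \<beta>) (g \<alpha>) (g \<beta>))"
      using g_gen(3)[of \<alpha>] \<alpha> by (intro sum.cong refl) (simp add: ns(2) g_eq Q_def E_def)
    finally show "(\<Sum>r<ns ! \<alpha>. \<Sum>\<beta><L. \<Sum>c<ns ! \<beta>.
        if c = \<iota> \<beta> then if r = \<iota> \<alpha> then cinner (bop_apply (Q \<alpha> \<beta> $$ (r, c)) (\<eta> \<beta>)) (\<eta> \<alpha>) else 0 else 0)
      = (\<Sum>\<beta><L. nc_form K (\<Phi> \<alpha> \<beta>) (g \<alpha>) (g \<beta>))" .
  qed
  \<comment> \<open>On padding indices \<open>\<Phi>\<close> is 0, and the form vanishes at
    0.\<close>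
  also have "\<dots> = (\<Sum>\<alpha><q. \<Sum>\<beta><q. nc_form K (\<Phi> \<alpha> \<beta>) (g \<alpha>) (g \<beta>))"
  proof -
    have "nc_form K 0 (g \<alpha>) (g \<beta>) = 0" for \<alpha> \<beta>
      using nc_form_linear(2)[OF \<Omega> S _ _ _ operator_systemD(1)[OF S], of K "g \<alpha>" "g \<beta>" 0] K g_T T(2)
      by (auto simp: cp_nc_kernel_def)
    thus ?thesis
      by (intro sum.mono_neutral_cong_right ballI sum.neutral) (auto simp: L_def \<Phi>_ge)
  qed
  also have "\<dots> = (\<Sum>\<alpha><q. \<Sum>\<beta><q. nc_form K (\<Sum>r<p. star (v r (ts ! \<alpha>)) * v r (ts ! \<beta>)) (ts ! \<alpha>) (ts ! \<beta>))"
    by (intro sum.cong refl) (simp add: \<Phi>_lt g_def)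
  also have "\<dots> = (\<Sum>g\<in>T. \<Sum>h\<in>T. nc_form K (\<Sum>r<p. star (v r g) * v r h) g h)"
  proof -
    have bij: "bij_betw ((!) ts) {..<q} T" using bij_betw_nth[OF ts(2)] ts(1) by (simp add: q_def)
    have inner: "(\<Sum>\<beta><q. F (ts ! \<beta>)) = (\<Sum>h\<in>T. F h)" for F :: "_ \<Rightarrow> complex"
      by (rule sum.reindex_bij_betw[OF bij])
    show ?thesis
      using inner[of "\<lambda>g. \<Sum>h\<in>T. nc_form K (\<Sum>r<p. star (v r g) * v r h) g h"]
      by (simp only: inner[where F = "\<lambda>h. nc_form K (\<Sum>r<p. star (v r _) * v r h) _ h"])
  qed
  finally show ?thesis .
qed simp

lemma locate_less:
  assumes "r < sum_list ns"
  shows "fst (locate ns r) < length ns" "snd (locate ns r) < ns ! fst (locate ns r)"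
    "sum_list (take (fst (locate ns r)) ns) + snd (locate ns r) = r"
proof -
  obtain i r' where "i < length ns" "r' < ns ! i" "r = sum_list (take i ns) + r'"
    by (rule offset_cases[OF assms])
  thus "fst (locate ns r) < length ns" "snd (locate ns r) < ns ! fst (locate ns r)"
    "sum_list (take (fst (locate ns r)) ns) + snd (locate ns r) = r"
    by (simp_all add: locate_offset)
qed

section \<open>Index rules for adjoints and for the action of scalar matrices\<close>

lemma dim_mat_adjoint [simp]: "dim_row (mat_adjoint A) = dim_col A" "dim_col (mat_adjoint A) = dim_row A"
  by (simp_all add: mat_adjoint_def)

lemma mat_adjoint_index:
  "i < dim_col A \<Longrightarrow> j < dim_row A \<Longrightarrow> mat_adjoint A $$ (i, j) = cnj (A $$ (j, i))"
  by (simp add: mat_adjoint_def mat_of_rows_def)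

lemma mat_adjoint_one: "mat_adjoint (1\<^sub>m n :: complex mat) = 1\<^sub>m n"
  by (rule eq_matI) (auto simp: mat_adjoint_index)

lemma lact_index:
  "i < dim_row \<alpha> \<Longrightarrow> j < dim_col M \<Longrightarrow> lact \<alpha> M $$ (i, j) = (\<Sum>k<dim_row M. (\<alpha> $$ (i, k)) *\<^sub>C (M $$ (k, j)))"
  by (simp add: lact_def)

lemma ract_index:
  "i < dim_row M \<Longrightarrow> j < dim_col \<beta> \<Longrightarrow> ract M \<beta> $$ (i, j) = (\<Sum>k<dim_col M. (\<beta> $$ (k, j)) *\<^sub>C (M $$ (i, k)))"
  by (simp add: ract_def)

lemma dim_lact [simp]: "dim_row (lact \<alpha> M) = dim_row \<alpha>" "dim_col (lact \<alpha> M) = dim_col M"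
  by (simp_all add: lact_def)

lemma dim_ract [simp]: "dim_row (ract M \<beta>) = dim_row M" "dim_col (ract M \<beta>) = dim_col \<beta>"
  by (simp_all add: ract_def)

lemma lact_one: "lact (1\<^sub>m n) M = M" if "dim_row M = n"
proof (rule eq_matI)
  fix i j assume "i < dim_row M" "j < dim_col M"
  moreover from this that have "(\<Sum>k<n. (1\<^sub>m n $$ (i, k)) *\<^sub>C (M $$ (k, j))) = (\<Sum>k<n. if k = i then M $$ (i, j) else 0)"
    by (intro sum.cong refl) (auto simp: scaleC_one)
  ultimately show "lact (1\<^sub>m n) M $$ (i, j) = M $$ (i, j)" using that by (simp add: lact_index)
qed (use that in auto)

lemma ract_one: "ract M (1\<^sub>m n) = M" if "dim_col M = n"
proof (rule eq_matI)
  fix i j assume "i < dim_row M" "j < dim_col M"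
  moreover from this that have "(\<Sum>k<n. (1\<^sub>m n $$ (k, j)) *\<^sub>C (M $$ (i, k))) = (\<Sum>k<n. if k = j then M $$ (i, j) else 0)"
    by (intro sum.cong refl) (auto simp: scaleC_one)
  ultimately show "ract M (1\<^sub>m n) $$ (i, j) = M $$ (i, j)" using that by (simp add: ract_index)
qed (use that in auto)

lemma sum_swap_pairs:
  "(\<Sum>a\<in>A. \<Sum>b\<in>B. \<Sum>c\<in>C. \<Sum>d\<in>D. f a b c d) =
    (\<Sum>c\<in>C. \<Sum>d\<in>D. \<Sum>a\<in>A. \<Sum>b\<in>B. f a b c d :: 'z::comm_monoid_add)"
proof -
  have Times: "(\<Sum>p\<in>A \<times> B. h p) = (\<Sum>a\<in>A. \<Sum>b\<in>B. h (a, b))" for h :: "_ \<Rightarrow> 'z"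
    by (simp add: sum.cartesian_product)
  have Times': "(\<Sum>p\<in>C \<times> D. h p) = (\<Sum>a\<in>C. \<Sum>b\<in>D. h (a, b))" for h :: "_ \<Rightarrow> 'z"
    by (simp add: sum.cartesian_product)
  have "(\<Sum>a\<in>A. \<Sum>b\<in>B. \<Sum>c\<in>C. \<Sum>d\<in>D. f a b c d) = (\<Sum>p\<in>A \<times> B. \<Sum>q\<in>C \<times> D. f (fst p) (snd p) (fst q) (snd q))"
    by (simp add: Times Times')
  also have "\<dots> = (\<Sum>q\<in>C \<times> D. \<Sum>p\<in>A \<times> B. f (fst p) (snd p) (fst q) (snd q))"
    by (rule sum.swap)
  also have "\<dots> = (\<Sum>c\<in>C. \<Sum>d\<in>D. \<Sum>a\<in>A. \<Sum>b\<in>B. f a b c d)"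
    by (simp add: Times Times')
  finally show ?thesis .
qed

section \<open>The kernel of an extended form\<close>

text \<open>The entry is the operator of the form summed over the entries of \<open>P\<close>. For
  points of \<open>\<Omega>\<close> such an operator exists, by \<open>form_operator\<close>, and is
  unique; for other points the choice is left unspecified.\<close>

definition kernel_of_form :: "('a \<Rightarrow> ('v, 'y) generator \<Rightarrow> ('v, 'y) generator \<Rightarrow> complex) \<Rightarrow>
    'v mat \<Rightarrow> 'v mat \<Rightarrow> 'a mat \<Rightarrow> 'y::chilbert_space bop mat" where
  "kernel_of_form \<sigma> Z W P = mat (dim_row Z) (dim_row W) (\<lambda>(i, j). SOME T. \<forall>x y.
     cinner (bop_apply T x) y =
       (\<Sum>k<dim_row Z. \<Sum>l<dim_row W. \<sigma> (P $$ (k, l)) (Z, k, i, y) (W, l, j, x)))"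

locale nc_form_extension =
  fixes \<Omega> :: "'v::complex_vector mat set" and S :: "'a::cstar_algebra set"
    and K :: "'v mat \<Rightarrow> 'v mat \<Rightarrow> 'a mat \<Rightarrow> 'y::chilbert_space bop mat"
    and \<sigma> :: "'a \<Rightarrow> ('v, 'y) generator \<Rightarrow> ('v, 'y) generator \<Rightarrow> complex"
  assumes \<Omega>: "\<Omega> \<subseteq> nc_space" and S: "operator_system S" and K: "nc_kernel \<Omega> S K"
    and \<sigma>: "cp_form \<sigma>"
    and \<sigma>_ext: "\<And>a g h. a \<in> S \<Longrightarrow> g \<in> generators \<Omega> \<Longrightarrow> h \<in> generators \<Omega> \<Longrightarrow> \<sigma> a g h = nc_form K a g h"
begin

abbreviation "K' \<equiv> kernel_of_form \<sigma>"

text \<open>The relation is checked against generators over \<open>\<Omega>\<close>, yet it follows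
  for every \<open>h\<close>: Cauchy-Schwarz consumes it only against the \<open>g j\<close>
  themselves, where the two forms agree at \<open>1\<close>.\<close>

lemma relation:
  assumes "finite I" and g: "\<And>i. i \<in> I \<Longrightarrow> g i \<in> generators \<Omega>"
    and null: "\<And>h. h \<in> generators \<Omega> \<Longrightarrow> (\<Sum>i\<in>I. w i * nc_form K 1 (g i) h) = 0"
  shows "(\<Sum>i\<in>I. w i * \<sigma> a (g i) h) = 0"
proof (rule cp_form_relation[OF \<sigma> assms(1)])
  fix j assume j: "j \<in> I"
  have "(\<Sum>i\<in>I. w i * \<sigma> 1 (g i) (g j)) = (\<Sum>i\<in>I. w i * nc_form K 1 (g i) (g j))"
    by (intro sum.cong refl arg_cong2[where f = "(*)"] \<sigma>_ext g j operator_systemD(4)[OF S])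
  also have "\<dots> = 0" by (rule null[OF g[OF j]])
  finally show "(\<Sum>i\<in>I. w i * \<sigma> 1 (g i) (g j)) = 0" .
qed

lemma hermitian: "\<sigma> a h g = cnj (\<sigma> (star a) g h)"
  using cp_form_hermitian[OF \<sigma>, of "star a" h g] by (simp add: star_star)

text \<open>The combination of the generators with vectors \<open>y + z\<close>, \<open>y\<close>,
  \<open>z\<close> and coefficients \<open>1, -1, -1\<close> is null at \<open>1\<close>. Indexing
  by numbers keeps the three apart even if the vectors coincide. The second slot follows by
  Hermitian symmetry.\<close>

lemma add_vector:
  assumes "(Z, k, i, y) \<in> generators \<Omega>"
  shows "\<sigma> a (Z, k, i, y + z) h = \<sigma> a (Z, k, i, y) h + \<sigma> a (Z, k, i, z) h"
    and "\<sigma> a h (Z, k, i, y + z) = \<sigma> a h (Z, k, i, y) + \<sigma> a h (Z, k, i, z)"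
proof -
  have 1: "\<sigma> a (Z, k, i, y + z) h = \<sigma> a (Z, k, i, y) h + \<sigma> a (Z, k, i, z) h" for a h
  proof -
    define w :: "nat \<Rightarrow> complex" where "w n = (if n = 0 then 1 else - 1)" for n
    define u where "u n = (if n = 0 then y + z else if n = 1 then y else z)" for n :: nat
    have "(\<Sum>n\<in>{0,1,2}. w n * \<sigma> a (Z, k, i, u n) h) = 0"
    proof (rule relation)
      fix h :: "('v, 'y) generator"
      show "(\<Sum>n\<in>{0,1,2}. w n * nc_form K 1 (Z, k, i, u n) h) = 0"
        by (cases h) (simp add: w_def u_def cinner_add_right)
    qed (use assms in \<open>auto simp: generators_def\<close>)
    thus ?thesis by (simp add: w_def u_def algebra_simps)
  qed
  show "\<sigma> a (Z, k, i, y + z) h = \<sigma> a (Z, k, i, y) h + \<sigma> a (Z, k, i, z) h" by (rule 1)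
  show "\<sigma> a h (Z, k, i, y + z) = \<sigma> a h (Z, k, i, y) + \<sigma> a h (Z, k, i, z)"
    unfolding hermitian[of a h] by (simp add: 1)
qed

lemma scaleC_vector:
  assumes "(Z, k, i, y) \<in> generators \<Omega>"
  shows "\<sigma> a (Z, k, i, c *\<^sub>C y) h = cnj c * \<sigma> a (Z, k, i, y) h"
    and "\<sigma> a h (Z, k, i, c *\<^sub>C y) = c * \<sigma> a h (Z, k, i, y)"
proof -
  have 1: "\<sigma> a (Z, k, i, c *\<^sub>C y) h = cnj c * \<sigma> a (Z, k, i, y) h" for a h
  proof -
    define w :: "nat \<Rightarrow> complex" where "w n = (if n = 0 then 1 else - cnj c)" for n
    define u where "u n = (if n = 0 then c *\<^sub>C y else y)" for n :: nat
    have "(\<Sum>n\<in>{0,1}. w n * \<sigma> a (Z, k, i, u n) h) = 0"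
    proof (rule relation)
      fix h :: "('v, 'y) generator"
      show "(\<Sum>n\<in>{0,1}. w n * nc_form K 1 (Z, k, i, u n) h) = 0"
        by (cases h) (simp add: w_def u_def cinner_scaleC_right)
    qed (use assms in \<open>auto simp: generators_def\<close>)
    thus ?thesis by (simp add: w_def u_def)
  qed
  show "\<sigma> a (Z, k, i, c *\<^sub>C y) h = cnj c * \<sigma> a (Z, k, i, y) h" by (rule 1)
  show "\<sigma> a h (Z, k, i, c *\<^sub>C y) = c * \<sigma> a h (Z, k, i, y)"
    unfolding hermitian[of a h] by (simp add: 1)
qed

lemma nc_form_expand:
  assumes "Z \<in> \<Omega>" and "W \<in> \<Omega>" and "P \<in> mats S (dim_row Z) (dim_row W)"
    and "i < dim_row Z" and "j < dim_row W"
  shows "cinner (bop_apply (K Z W P $$ (i, j)) x) y =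
    (\<Sum>k<dim_row Z. \<Sum>l<dim_row W. nc_form K (P $$ (k, l)) (Z, k, i, y) (W, l, j, x))"
  using linear_on_mats_expand[OF S nc_kernel_level(2,1)[OF \<Omega> K assms(1,2)] assms(3-5)]
  by (simp add: bop_apply_sum cinner_sum_left)

text \<open>Take \<open>\<beta>\<close> to be the identity and apply the kernel to the matrix unit
  at \<open>(k, l)\<close>. Multiplying the value by \<open>\<alpha>\<close> combines its rows
  \<open>i\<close>, which is the left side; multiplying the argument turns the unit into a
  combination of the units at \<open>(k', l)\<close>, which is the right side.\<close>

lemma nc_form_intertwining:
  assumes Z: "Z \<in> \<Omega>" "Z' \<in> \<Omega>" and \<alpha>: "\<alpha> \<in> carrier_mat (dim_row Z') (dim_row Z)" "lact \<alpha> Z = ract Z' \<alpha>"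
    and k: "k < dim_row Z" and i': "i' < dim_row Z'" and h: "h \<in> generators \<Omega>"
  shows "(\<Sum>i<dim_row Z. \<alpha> $$ (i', i) * nc_form K 1 (Z, k, i, y) h) =
    (\<Sum>k'<dim_row Z'. \<alpha> $$ (k', k) * nc_form K 1 (Z', k', i', y) h)"
proof -
  obtain W l j x where h': "h = (W, l, j, x)" and W: "W \<in> \<Omega>" "l < dim_row W" "j < dim_row W"
    using h by (auto simp: generators_def)
  define n where "n = dim_row Z"
  define n' where "n' = dim_row Z'"
  define m where "m = dim_row W"
  note dims = n_def[symmetric] n'_def[symmetric] m_def[symmetric]
  define E where "E = elem_mat n m k l (1::'a)"
  have W_dim: "W \<in> carrier_mat m m" using nc_space_dim[of W] \<Omega> W(1) by (auto simp: m_def)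
  have E: "E \<in> mats S n m" unfolding E_def by (rule elem_mat_mats[OF S operator_systemD(4)[OF S]])
  have KE: "K Z W E \<in> carrier_mat n m"
    using nc_kernel_level(1)[OF \<Omega> K Z(1) W(1)] E by (auto simp: dims)
  have lactE: "lact \<alpha> E $$ (k', l') = (if l' = l then (\<alpha> $$ (k', k)) *\<^sub>C 1 else 0)" if "k' < n'" "l' < m" for k' l'
  proof -
    have "lact \<alpha> E $$ (k', l') = (\<Sum>r<n. (\<alpha> $$ (k', r)) *\<^sub>C (E $$ (r, l')))"
      using that \<alpha>(1) by (simp add: lact_index E_def n'_def)
    also have "\<dots> = (\<Sum>r<n. if r = k then if l' = l then (\<alpha> $$ (k', k)) *\<^sub>C 1 else 0 else 0)"
      using that by (intro sum.cong refl) (simp add: E_def)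
    finally have "lact \<alpha> E $$ (k', l') = \<dots>" .
    thus ?thesis using k by (simp add: dims)
  qed
  have lactE_mats: "lact \<alpha> E \<in> mats S n' m"
  proof -
    have "lact \<alpha> E \<in> carrier_mat n' m" using \<alpha>(1) by (auto simp: E_def n'_def)
    thus ?thesis using operator_systemD[OF S] by (auto simp: mats_iff lactE)
  qed
  have "ract (lact \<alpha> (K Z W E)) (mat_adjoint (1\<^sub>m m)) = K Z' W (ract (lact \<alpha> E) (mat_adjoint (1\<^sub>m m)))"
  proof -
    have "Z \<in> graded_level \<Omega> n" "Z' \<in> graded_level \<Omega> n'" "W \<in> graded_level \<Omega> m"
      using Z W by (simp_all add: graded_level_iff[OF \<Omega>] dims)
    moreover have "lact (1\<^sub>m m) W = ract W (1\<^sub>m m)" using W_dim by (simp add: lact_one ract_one)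
    moreover have "\<alpha> \<in> carrier_mat n' n" using \<alpha>(1) by (simp add: dims)
    moreover have "1\<^sub>m m \<in> carrier_mat m m" by simp
    ultimately show ?thesis using K \<alpha>(2) E unfolding nc_kernel_def by blast
  qed
  hence intertw: "lact \<alpha> (K Z W E) = K Z' W (lact \<alpha> E)"
    using KE by (simp add: mat_adjoint_one ract_one E_def)
  have "(\<Sum>i<n. \<alpha> $$ (i', i) * nc_form K 1 (Z, k, i, y) h) = cinner (bop_apply (lact \<alpha> (K Z W E) $$ (i', j)) x) y"
    using KE \<alpha>(1) i' W(3)
    by (simp add: lact_index dims h' E_def bop_apply_sum bop_apply_scaleC cinner_sum_left cinner_scaleC_left)
  also have "\<dots> = (\<Sum>k'<n'. \<Sum>l'<m. nc_form K (lact \<alpha> E $$ (k', l')) (Z', k', i', y) (W, l', j, x))"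
    unfolding intertw dims[symmetric]
    by (rule nc_form_expand) (use Z W i' lactE_mats in \<open>simp_all add: dims\<close>)
  also have "\<dots> = (\<Sum>k'<n'. \<Sum>l'<m. if l' = l then \<alpha> $$ (k', k) * nc_form K 1 (Z', k', i', y) (W, l', j, x) else 0)"
  proof (intro sum.cong refl)
    fix k' l' assume "k' \<in> {..<n'}" "l' \<in> {..<m}"
    hence k': "k' < n'" "l' < m" by auto
    hence gen: "(Z', k', i', y) \<in> generators \<Omega>" "(W, l', j, x) \<in> generators \<Omega>"
      using Z W i' by (auto simp: generators_def dims)
    note lin = nc_form_linear(2)[OF \<Omega> S K gen operator_systemD(4)[OF S]]
    from lin[of 0] lin[of "\<alpha> $$ (k', k)"]
    show "nc_form K (lact \<alpha> E $$ (k', l')) (Z', k', i', y) (W, l', j, x) =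
      (if l' = l then \<alpha> $$ (k', k) * nc_form K 1 (Z', k', i', y) (W, l', j, x) else 0)"
      using k' by (cases "l' = l") (simp_all add: lactE del: nc_form.simps)
  qed
  also have "\<dots> = (\<Sum>k'<n'. \<alpha> $$ (k', k) * nc_form K 1 (Z', k', i', y) h)"
    using W(2) by (simp add: dims h' del: nc_form.simps)
  finally show ?thesis by (simp add: dims)
qed

text \<open>The difference of the two sides is one relation over the disjoint sum of the index sets.
  For the second slot, conjugate the first identity at \<open>star a\<close>.\<close>

lemma intertwining:
  assumes Z: "Z \<in> \<Omega>" "Z' \<in> \<Omega>" and \<alpha>: "\<alpha> \<in> carrier_mat (dim_row Z') (dim_row Z)" "lact \<alpha> Z = ract Z' \<alpha>"
    and k: "k < dim_row Z" and i': "i' < dim_row Z'"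
  shows "(\<Sum>i<dim_row Z. \<alpha> $$ (i', i) * \<sigma> a (Z, k, i, y) h) =
      (\<Sum>k'<dim_row Z'. \<alpha> $$ (k', k) * \<sigma> a (Z', k', i', y) h)"
    and "(\<Sum>i<dim_row Z. cnj (\<alpha> $$ (i', i)) * \<sigma> a h (Z, k, i, y)) =
      (\<Sum>k'<dim_row Z'. cnj (\<alpha> $$ (k', k)) * \<sigma> a h (Z', k', i', y))"
proof -
  have 1: "(\<Sum>i<dim_row Z. \<alpha> $$ (i', i) * \<sigma> a (Z, k, i, y) h) =
      (\<Sum>k'<dim_row Z'. \<alpha> $$ (k', k) * \<sigma> a (Z', k', i', y) h)" for a h
  proof -
    define w where "w = case_sum (\<lambda>i. \<alpha> $$ (i', i)) (\<lambda>k'. - \<alpha> $$ (k', k))"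
    define g where "g = case_sum (\<lambda>i. (Z, k, i, y)) (\<lambda>k'. (Z', k', i', y))"
    have "(\<Sum>r\<in>{..<dim_row Z} <+> {..<dim_row Z'}. w r * \<sigma> a (g r) h) = 0"
    proof (rule relation)
      show "(\<Sum>r\<in>{..<dim_row Z} <+> {..<dim_row Z'}. w r * nc_form K 1 (g r) h) = 0"
        if "h \<in> generators \<Omega>" for h
        using nc_form_intertwining[OF assms that, of y]
        by (simp add: sum.Plus w_def g_def sum_negf del: nc_form.simps)
    qed (use Z k i' in \<open>auto simp: g_def generators_def\<close>)
    thus ?thesis by (simp add: sum.Plus w_def g_def sum_negf)
  qed
  show "(\<Sum>i<dim_row Z. \<alpha> $$ (i', i) * \<sigma> a (Z, k, i, y) h) =
      (\<Sum>k'<dim_row Z'. \<alpha> $$ (k', k) * \<sigma> a (Z', k', i', y) h)" by (rule 1)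
  have "cnj (\<Sum>i<dim_row Z. \<alpha> $$ (i', i) * \<sigma> (star a) (Z, k, i, y) h) =
      cnj (\<Sum>k'<dim_row Z'. \<alpha> $$ (k', k) * \<sigma> (star a) (Z', k', i', y) h)"
    by (simp only: 1)
  thus "(\<Sum>i<dim_row Z. cnj (\<alpha> $$ (i', i)) * \<sigma> a h (Z, k, i, y)) =
      (\<Sum>k'<dim_row Z'. cnj (\<alpha> $$ (k', k)) * \<sigma> a h (Z', k', i', y))"
    by (simp add: hermitian[of a h])
qed

text \<open>At \<open>1\<close> the form still comes from the operators of \<open>K\<close>, which
  are bounded. Through \<open>cp_form_bound\<close> this is the source of boundedness at every other
  element.\<close>

lemma diagonal_bound:
  assumes "Z \<in> \<Omega>" and "k < dim_row Z" and "i < dim_row Z"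
  shows "\<exists>c\<ge>0. \<forall>y. Re (\<sigma> 1 (Z, k, i, y) (Z, k, i, y)) \<le> c * (norm y)\<^sup>2"
proof -
  define T where "T = K Z Z (elem_mat (dim_row Z) (dim_row Z) k k 1) $$ (i, i)"
  obtain c where c: "c \<ge> 0" "\<And>y. norm (bop_apply T y) \<le> norm y * c"
    using bounded_linear.nonneg_bounded[OF bop_apply_linear(4)[of T]] by blast
  have "Re (\<sigma> 1 (Z, k, i, y) (Z, k, i, y)) \<le> c * (norm y)\<^sup>2" for y
  proof -
    have "(Z, k, i, y) \<in> generators \<Omega>" using assms by (simp add: generators_def)
    hence "Re (\<sigma> 1 (Z, k, i, y) (Z, k, i, y)) = Re (cinner (bop_apply T y) y)"
      using operator_systemD(4)[OF S] by (simp add: \<sigma>_ext T_def)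
    also have "\<dots> \<le> norm (bop_apply T y) * norm y"
      using complex_Re_le_cmod cinner_Cauchy_Schwarz order_trans by blast
    also have "\<dots> \<le> norm y * c * norm y" by (intro mult_right_mono c) simp
    finally show ?thesis by (simp add: power2_eq_square mult_ac)
  qed
  with c(1) show ?thesis by blast
qed

lemma form_operator:
  assumes Z: "Z \<in> \<Omega>" "k < dim_row Z" "i < dim_row Z" and W: "W \<in> \<Omega>" "l < dim_row W" "j < dim_row W"
  shows "\<exists>T. \<forall>x y. cinner (bop_apply T x) y = \<sigma> a (Z, k, i, y) (W, l, j, x)"
proof -
  have gen: "(Z, k, i, y) \<in> generators \<Omega>" "(W, l, j, y) \<in> generators \<Omega>" for y
    using assms by (simp_all add: generators_def)
  obtain c where c: "c \<ge> 0" "\<And>g h. (cmod (\<sigma> a g h))\<^sup>2 \<le> c * Re (\<sigma> 1 g g) * Re (\<sigma> 1 h h)"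
    using cp_form_bound[OF \<sigma>] by blast
  obtain c1 where c1: "c1 \<ge> 0" "\<And>y. Re (\<sigma> 1 (Z, k, i, y) (Z, k, i, y)) \<le> c1 * (norm y)\<^sup>2"
    using diagonal_bound[OF Z] by blast
  obtain c2 where c2: "c2 \<ge> 0" "\<And>y. Re (\<sigma> 1 (W, l, j, y) (W, l, j, y)) \<le> c2 * (norm y)\<^sup>2"
    using diagonal_bound[OF W] by blast
  have "cmod (\<sigma> a (Z, k, i, y) (W, l, j, x)) \<le> sqrt (c * c1 * c2) * norm x * norm y" for x y
  proof (rule power2_le_imp_le)
    have nonneg: "0 \<le> Re (\<sigma> 1 g g)" for g
      using cp_form_pos[OF \<sigma>, of "{g}" "\<lambda>_. 1"] by (simp add: less_eq_complex_def)
    have "(cmod (\<sigma> a (Z, k, i, y) (W, l, j, x)))\<^sup>2 \<le>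
        c * Re (\<sigma> 1 (Z, k, i, y) (Z, k, i, y)) * Re (\<sigma> 1 (W, l, j, x) (W, l, j, x))" by (rule c(2))
    also have "\<dots> \<le> c * (c1 * (norm y)\<^sup>2) * (c2 * (norm x)\<^sup>2)"
      using c(1) c1 c2 nonneg by (intro mult_mono mult_nonneg_nonneg) auto
    also have "\<dots> = (sqrt (c * c1 * c2) * norm x * norm y)\<^sup>2"
      using c(1) c1(1) c2(1) by (simp add: power_mult_distrib)
    finally show "(cmod (\<sigma> a (Z, k, i, y) (W, l, j, x)))\<^sup>2 \<le> (sqrt (c * c1 * c2) * norm x * norm y)\<^sup>2" .
    show "0 \<le> sqrt (c * c1 * c2) * norm x * norm y" using c(1) c1(1) c2(1) by simp
  qed
  thus ?thesis
    by (intro bounded_sesquilinear_form_bop[of "\<lambda>x y. \<sigma> a (Z, k, i, y) (W, l, j, x)"])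
       (simp_all add: add_vector[OF gen(1)] add_vector[OF gen(2)] scaleC_vector[OF gen(1)] scaleC_vector[OF gen(2)])
qed

section \<open>The extended kernel: entries, linearity, intertwinings and complete
  positivity\<close>

lemma dim_K' [simp]: "dim_row (K' Z W P) = dim_row Z" "dim_col (K' Z W P) = dim_row W"
  by (simp_all add: kernel_of_form_def)

lemma K'_entry:
  assumes "Z \<in> \<Omega>" "i < dim_row Z" "W \<in> \<Omega>" "j < dim_row W"
  shows "cinner (bop_apply (K' Z W P $$ (i, j)) x) y =
    (\<Sum>k<dim_row Z. \<Sum>l<dim_row W. \<sigma> (P $$ (k, l)) (Z, k, i, y) (W, l, j, x))"
proof -
  define Q where "Q T \<longleftrightarrow> (\<forall>x y. cinner (bop_apply T x) y =
    (\<Sum>k<dim_row Z. \<Sum>l<dim_row W. \<sigma> (P $$ (k, l)) (Z, k, i, y) (W, l, j, x)))" for T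
  have "\<exists>T. \<forall>x y. cinner (bop_apply T x) y = \<sigma> (P $$ (k, l)) (Z, k, i, y) (W, l, j, x)"
    if "k < dim_row Z" "l < dim_row W" for k l
    using assms that by (intro form_operator) auto
  then obtain T where T: "\<And>k l x y. k < dim_row Z \<Longrightarrow> l < dim_row W \<Longrightarrow>
      cinner (bop_apply (T k l) x) y = \<sigma> (P $$ (k, l)) (Z, k, i, y) (W, l, j, x)"
    by metis
  hence "Q (\<Sum>k<dim_row Z. \<Sum>l<dim_row W. T k l)"
    by (simp add: Q_def bop_apply_sum cinner_sum_left)
  hence "Q (SOME T. Q T)" by (rule someI)
  moreover have "K' Z W P $$ (i, j) = (SOME T. Q T)"
    using assms by (simp add: kernel_of_form_def Q_def)
  ultimately show ?thesis by (simp add: Q_def)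
qed

lemma K'_eqI:
  assumes "Z \<in> \<Omega>" "W \<in> \<Omega>" and "M \<in> carrier_mat (dim_row Z) (dim_row W)"
    and "\<And>i j x y. i < dim_row Z \<Longrightarrow> j < dim_row W \<Longrightarrow>
      (\<Sum>k<dim_row Z. \<Sum>l<dim_row W. \<sigma> (P $$ (k, l)) (Z, k, i, y) (W, l, j, x)) = cinner (bop_apply (M $$ (i, j)) x) y"
  shows "K' Z W P = M"
proof (rule eq_matI)
  fix i j assume "i < dim_row M" "j < dim_col M"
  hence ij: "i < dim_row Z" "j < dim_row W" using assms(3) by auto
  show "K' Z W P $$ (i, j) = M $$ (i, j)"
    by (rule bop_eqI) (simp only: K'_entry[OF assms(1) ij(1) assms(2) ij(2)] assms(4)[OF ij])
qed (use assms(3) in simp_all)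

lemma K'_extends:
  assumes "Z \<in> \<Omega>" "W \<in> \<Omega>" and P: "P \<in> mats S (dim_row Z) (dim_row W)"
  shows "K' Z W P = K Z W P"
proof (rule K'_eqI[OF assms(1,2)])
  show "K Z W P \<in> carrier_mat (dim_row Z) (dim_row W)"
    using nc_kernel_level(1)[OF \<Omega> K assms(1,2)] P by blast
  fix i j x y assume ij: "i < dim_row Z" "j < dim_row W"
  show "(\<Sum>k<dim_row Z. \<Sum>l<dim_row W. \<sigma> (P $$ (k, l)) (Z, k, i, y) (W, l, j, x)) = cinner (bop_apply (K Z W P $$ (i, j)) x) y"
    unfolding nc_form_expand[OF assms ij]
  proof (rule sum.cong[OF refl], rule sum.cong[OF refl])
    fix k l assume "k \<in> {..<dim_row Z}" "l \<in> {..<dim_row W}"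
    hence "k < dim_row Z" "l < dim_row W" by simp_all
    thus "\<sigma> (P $$ (k, l)) (Z, k, i, y) (W, l, j, x) = nc_form K (P $$ (k, l)) (Z, k, i, y) (W, l, j, x)"
      using P assms(1,2) ij by (intro \<sigma>_ext) (simp_all add: mats_iff generators_def)
  qed
qed

lemma K'_linear:
  assumes "Z \<in> \<Omega>" "W \<in> \<Omega>"
  shows "linear_on_mats (mats UNIV (dim_row Z) (dim_row W)) (K' Z W)"
  unfolding linear_on_mats_def
proof (intro conjI ballI allI)
  fix P Q :: "'a mat" and c
  assume "P \<in> mats UNIV (dim_row Z) (dim_row W)"
  hence P: "dim_row P = dim_row Z" "dim_col P = dim_row W" by (auto simp: mats_def)
  show "K' Z W (map_mat (scaleC c) P) = map_mat (scaleC c) (K' Z W P)"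
  proof (rule K'_eqI[OF assms])
    show "map_mat (scaleC c) (K' Z W P) \<in> carrier_mat (dim_row Z) (dim_row W)"
      by (rule carrier_matI) simp_all
    fix i j x y assume ij: "i < dim_row Z" "j < dim_row W"
    have "cinner (bop_apply (map_mat (scaleC c) (K' Z W P) $$ (i, j)) x) y =
        c * cinner (bop_apply (K' Z W P $$ (i, j)) x) y"
      using ij by (simp add: bop_apply_scaleC cinner_scaleC_left)
    thus "(\<Sum>k<dim_row Z. \<Sum>l<dim_row W. \<sigma> (map_mat (scaleC c) P $$ (k, l)) (Z, k, i, y) (W, l, j, x)) =
        cinner (bop_apply (map_mat (scaleC c) (K' Z W P) $$ (i, j)) x) y"
      by (simp add: P K'_entry[OF assms(1) ij(1) assms(2) ij(2)] cp_form_scaleC[OF \<sigma>] sum_distrib_left)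
  qed
  assume "Q \<in> mats UNIV (dim_row Z) (dim_row W)"
  hence Q: "dim_row Q = dim_row Z" "dim_col Q = dim_row W" by (auto simp: mats_def)
  show "K' Z W (P + Q) = K' Z W P + K' Z W Q"
  proof (rule K'_eqI[OF assms])
    show "K' Z W P + K' Z W Q \<in> carrier_mat (dim_row Z) (dim_row W)"
      by (rule carrier_matI) simp_all
    fix i j x y assume ij: "i < dim_row Z" "j < dim_row W"
    have "cinner (bop_apply ((K' Z W P + K' Z W Q) $$ (i, j)) x) y =
        cinner (bop_apply (K' Z W P $$ (i, j)) x) y + cinner (bop_apply (K' Z W Q $$ (i, j)) x) y"
      using ij by (simp add: bop_apply_add cinner_add_left)
    thus "(\<Sum>k<dim_row Z. \<Sum>l<dim_row W. \<sigma> ((P + Q) $$ (k, l)) (Z, k, i, y) (W, l, j, x)) =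
        cinner (bop_apply ((K' Z W P + K' Z W Q) $$ (i, j)) x) y"
      by (simp add: P Q K'_entry[OF assms(1) ij(1) assms(2) ij(2)] cp_form_add[OF \<sigma>] sum.distrib)
  qed
qed

text \<open>By linearity each entry of \<open>P\<close> can be treated alone. Acting on
  \<open>P\<close>, the matrix \<open>\<alpha>\<close> sums over the label \<open>k'\<close> of
  generators at \<open>Z'\<close>; \<open>intertwining\<close> trades this for a sum over the label
  \<open>i\<close> of generators at \<open>Z\<close>, which is \<open>\<alpha>\<close> acting on the
  value. The second slot does the same for \<open>\<beta>\<close>, with the conjugates that belong
  to its adjoint.\<close>

lemma K'_intertwining:
  assumes Z: "Z \<in> \<Omega>" "Z' \<in> \<Omega>" and W: "W \<in> \<Omega>" "W' \<in> \<Omega>"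
    and \<alpha>: "\<alpha> \<in> carrier_mat (dim_row Z') (dim_row Z)" "lact \<alpha> Z = ract Z' \<alpha>"
    and \<beta>: "\<beta> \<in> carrier_mat (dim_row W') (dim_row W)" "lact \<beta> W = ract W' \<beta>"
    and P: "P \<in> carrier_mat (dim_row Z) (dim_row W)"
  shows "K' Z' W' (ract (lact \<alpha> P) (mat_adjoint \<beta>)) = ract (lact \<alpha> (K' Z W P)) (mat_adjoint \<beta>)"
proof (rule K'_eqI[OF Z(2) W(2)])
  show "ract (lact \<alpha> (K' Z W P)) (mat_adjoint \<beta>) \<in> carrier_mat (dim_row Z') (dim_row W')"
    using \<alpha>(1) \<beta>(1) by (intro carrier_matI) simp_all
  fix i' j' x y assume ij: "i' < dim_row Z'" "j' < dim_row W'"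
  define n n' m m' where "n = dim_row Z" and "n' = dim_row Z'" and "m = dim_row W" and "m' = dim_row W'"
  note dims = n_def[symmetric] n'_def[symmetric] m_def[symmetric] m'_def[symmetric]
  let ?s = "\<lambda>k l. \<sigma> (P $$ (k, l))"
  have "(\<Sum>k'<n'. \<Sum>l'<m'. \<sigma> (ract (lact \<alpha> P) (mat_adjoint \<beta>) $$ (k', l')) (Z', k', i', y) (W', l', j', x))
    = (\<Sum>k'<n'. \<Sum>l'<m'. \<Sum>l<m. \<Sum>k<n. cnj (\<beta> $$ (l', l)) * (\<alpha> $$ (k', k) * ?s k l (Z', k', i', y) (W', l', j', x)))"
    using \<alpha>(1) \<beta>(1) P
    by (intro sum.cong refl)
       (simp add: ract_index lact_index mat_adjoint_index dims cp_form_sum[OF \<sigma>] cp_form_scaleC[OF \<sigma>] sum_distrib_left)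
  also have "\<dots> = (\<Sum>l<m. \<Sum>k<n. \<Sum>k'<n'. \<Sum>l'<m'. cnj (\<beta> $$ (l', l)) * (\<alpha> $$ (k', k) * ?s k l (Z', k', i', y) (W', l', j', x)))"
    by (rule sum_swap_pairs)
  also have "\<dots> = (\<Sum>l<m. \<Sum>k<n. \<Sum>j<m. \<Sum>i<n. cnj (\<beta> $$ (j', j)) * (\<alpha> $$ (i', i) * ?s k l (Z, k, i, y) (W, l, j, x)))"
  proof (rule sum.cong[OF refl], rule sum.cong[OF refl])
    fix l k assume "l \<in> {..<m}" "k \<in> {..<n}"
    hence lk: "l < dim_row W" "k < dim_row Z" by (auto simp: dims)
    have "(\<Sum>k'<n'. \<Sum>l'<m'. cnj (\<beta> $$ (l', l)) * (\<alpha> $$ (k', k) * ?s k l (Z', k', i', y) (W', l', j', x)))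
      = (\<Sum>k'<n'. \<alpha> $$ (k', k) * (\<Sum>l'<m'. cnj (\<beta> $$ (l', l)) * ?s k l (Z', k', i', y) (W', l', j', x)))"
      by (simp add: sum_distrib_left mult_ac)
    also have "\<dots> = (\<Sum>k'<n'. \<alpha> $$ (k', k) * (\<Sum>j<m. cnj (\<beta> $$ (j', j)) * ?s k l (Z', k', i', y) (W, l, j, x)))"
      using intertwining(2)[OF W \<beta> lk(1) ij(2)] by (simp add: dims)
    also have "\<dots> = (\<Sum>j<m. cnj (\<beta> $$ (j', j)) * (\<Sum>k'<n'. \<alpha> $$ (k', k) * ?s k l (Z', k', i', y) (W, l, j, x)))"
      unfolding sum_distrib_left by (subst sum.swap) (simp add: mult_ac)
    also have "\<dots> = (\<Sum>j<m. cnj (\<beta> $$ (j', j)) * (\<Sum>i<n. \<alpha> $$ (i', i) * ?s k l (Z, k, i, y) (W, l, j, x)))"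
      using intertwining(1)[OF Z \<alpha> lk(2) ij(1)] by (simp add: dims)
    finally show "(\<Sum>k'<n'. \<Sum>l'<m'. cnj (\<beta> $$ (l', l)) * (\<alpha> $$ (k', k) * ?s k l (Z', k', i', y) (W', l', j', x)))
      = (\<Sum>j<m. \<Sum>i<n. cnj (\<beta> $$ (j', j)) * (\<alpha> $$ (i', i) * ?s k l (Z, k, i, y) (W, l, j, x)))"
      by (simp add: sum_distrib_left)
  qed
  also have "\<dots> = (\<Sum>j<m. \<Sum>i<n. \<Sum>l<m. \<Sum>k<n. cnj (\<beta> $$ (j', j)) * (\<alpha> $$ (i', i) * ?s k l (Z, k, i, y) (W, l, j, x)))"
    by (rule sum_swap_pairs)
  also have "\<dots> = (\<Sum>j<m. \<Sum>i<n. cnj (\<beta> $$ (j', j)) * (\<alpha> $$ (i', i) * (\<Sum>k<n. \<Sum>l<m. ?s k l (Z, k, i, y) (W, l, j, x))))"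
    by (subst (2) sum.swap) (simp add: sum_distrib_left)
  also have "\<dots> = cinner (bop_apply (ract (lact \<alpha> (K' Z W P)) (mat_adjoint \<beta>) $$ (i', j')) x) y"
    using \<alpha>(1) \<beta>(1) ij Z W
    by (simp add: ract_index lact_index mat_adjoint_index dims bop_apply_sum bop_apply_scaleC
        cinner_sum_left cinner_scaleC_left K'_entry sum_distrib_left)
  finally show "(\<Sum>k<dim_row Z'. \<Sum>l<dim_row W'. \<sigma> (ract (lact \<alpha> P) (mat_adjoint \<beta>) $$ (k, l)) (Z', k, i', y) (W', l, j', x))
    = cinner (bop_apply (ract (lact \<alpha> (K' Z W P)) (mat_adjoint \<beta>) $$ (i', j')) x) y"
    by (simp add: dims)
qed

lemma K'_nc_kernel: "nc_kernel \<Omega> UNIV K'"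
  unfolding nc_kernel_def
proof (intro conjI allI ballI impI)
  fix n m Z W assume "Z \<in> graded_level \<Omega> n" "W \<in> graded_level \<Omega> m"
  hence ZW: "Z \<in> \<Omega>" "W \<in> \<Omega>" "n = dim_row Z" "m = dim_row W" by (simp_all add: graded_level_iff[OF \<Omega>])
  show "K' Z W \<in> mats UNIV n m \<rightarrow> carrier_mat n m" unfolding ZW(3,4) by (intro funcsetI carrier_matI) simp_all
  show "linear_on_mats (mats UNIV n m) (K' Z W)" unfolding ZW(3,4) by (rule K'_linear[OF ZW(1,2)])
next
  fix n n' m m' Z Z' W W' \<alpha> \<beta> and P :: "'a mat"
  assume "Z \<in> graded_level \<Omega> n" "Z' \<in> graded_level \<Omega> n'" "W \<in> graded_level \<Omega> m" "W' \<in> graded_level \<Omega> m'"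
  hence *: "Z \<in> \<Omega>" "Z' \<in> \<Omega>" "W \<in> \<Omega>" "W' \<in> \<Omega>" "n = dim_row Z" "n' = dim_row Z'" "m = dim_row W" "m' = dim_row W'"
    by (simp_all add: graded_level_iff[OF \<Omega>])
  assume "\<alpha> \<in> carrier_mat n' n" "\<beta> \<in> carrier_mat m' m" "P \<in> mats UNIV n m"
    and "lact \<alpha> Z = ract Z' \<alpha>" "lact \<beta> W = ract W' \<beta>"
  thus "ract (lact \<alpha> (K' Z W P)) (mat_adjoint \<beta>) = K' Z' W' (ract (lact \<alpha> P) (mat_adjoint \<beta>))"
    by (intro K'_intertwining[symmetric] *(1-4)) (simp_all add: *(5-8) mats_def)
qed

text \<open>If the assembled argument is \<open>star_mat B * B\<close>, each row of \<open>B\<close>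
  supplies the elements for one instance of \<open>cp_form_pos_family\<close>, and the quadratic
  form of the values is the sum of these over all rows. The family may repeat generators, as the
  list may repeat points.\<close>

lemma K'_completely_positive:
  assumes Zs: "set Zs \<subseteq> \<Omega>"
  defines "ns \<equiv> map dim_row Zs"
  shows "completely_positive UNIV (sum_list ns)
    (\<lambda>P. assemble ns (\<lambda>i j. K' (Zs ! i) (Zs ! j) (block ns P i j)))"
proof -
  define N where "N = sum_list ns"
  define \<psi> where "\<psi> P = assemble ns (\<lambda>i j. K' (Zs ! i) (Zs ! j) (block ns P i j))" for P
  have len: "length ns = length Zs" by (simp add: ns_def)
  have Z: "Zs ! z \<in> \<Omega>" "dim_row (Zs ! z) = ns ! z" if "z < length ns" for z
    using that Zs by (auto simp: ns_def)
  have \<psi>_carrier: "\<psi> P \<in> carrier_mat N N" for P by (simp add: \<psi>_def N_def)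
  have \<psi>_dim: "dim_row (\<psi> P) = N" "dim_col (\<psi> P) = N" for P using \<psi>_carrier[of P] by auto
  define z where "z r = fst (locate ns r)" for r
  define i where "i r = snd (locate ns r)" for r
  define off where "off r = sum_list (take (z r) ns)" for r
  have loc: "z r < length ns" "i r < ns ! z r" if "r < N" for r
    using locate_less[of r ns] that by (simp_all add: z_def i_def N_def)
  have off_less: "off r + k < N" if "r < N" "k < ns ! z r" for r k
    using offset_less[of "z r" ns k] loc(1)[OF that(1)] that(2) by (simp add: off_def N_def)
  have \<psi>_entry: "cinner (bop_apply (\<psi> P $$ (r, c)) x) y =
      (\<Sum>k<ns ! z r. \<Sum>l<ns ! z c. \<sigma> (P $$ (off r + k, off c + l)) (Zs ! z r, k, i r, y) (Zs ! z c, l, i c, x))"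
    if rc: "r < N" "c < N" for P r c x y
  proof -
    have "\<psi> P $$ (r, c) = K' (Zs ! z r) (Zs ! z c) (block ns P (z r) (z c)) $$ (i r, i c)"
      using rc by (simp add: \<psi>_def assemble_def N_def z_def i_def case_prod_beta Let_def)
    thus ?thesis using rc by (simp add: K'_entry Z loc off_def)
  qed
  have \<psi>_eqI: "\<psi> P = M" if M: "M \<in> carrier_mat N N"
    and eq: "\<And>r c x y. r < N \<Longrightarrow> c < N \<Longrightarrow> cinner (bop_apply (\<psi> P $$ (r, c)) x) y = cinner (bop_apply (M $$ (r, c)) x) y" for P M
  proof (rule eq_matI)
    show "\<psi> P $$ (r, c) = M $$ (r, c)" if "r < dim_row M" "c < dim_col M" for r c
      using that M by (intro bop_eqI eq) auto
  qed (use M in \<open>simp_all add: \<psi>_dim\<close>)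
  have "linear_on_mats (mats UNIV N N) \<psi>"
    unfolding linear_on_mats_def
  proof (intro conjI ballI allI)
    fix P Q :: "'a mat" and c
    assume "P \<in> mats UNIV N N"
    hence P: "dim_row P = N" "dim_col P = N" by (auto simp: mats_def)
    show "\<psi> (map_mat (scaleC c) P) = map_mat (scaleC c) (\<psi> P)"
    proof (rule \<psi>_eqI)
      show "map_mat (scaleC c) (\<psi> P) \<in> carrier_mat N N" using \<psi>_carrier by simp
      fix r c' x y assume rc: "r < N" "c' < N"
      have "cinner (bop_apply (map_mat (scaleC c) (\<psi> P) $$ (r, c')) x) y = c * cinner (bop_apply (\<psi> P $$ (r, c')) x) y"
        using rc by (simp add: \<psi>_dim bop_apply_scaleC cinner_scaleC_left)
      thus "cinner (bop_apply (\<psi> (map_mat (scaleC c) P) $$ (r, c')) x) y =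
          cinner (bop_apply (map_mat (scaleC c) (\<psi> P) $$ (r, c')) x) y"
        using rc by (simp add: P \<psi>_entry off_less cp_form_scaleC[OF \<sigma>] sum_distrib_left)
    qed
    assume "Q \<in> mats UNIV N N"
    hence Q: "dim_row Q = N" "dim_col Q = N" by (auto simp: mats_def)
    show "\<psi> (P + Q) = \<psi> P + \<psi> Q"
    proof (rule \<psi>_eqI)
      show "\<psi> P + \<psi> Q \<in> carrier_mat N N" using \<psi>_carrier by simp
      fix r c x y assume rc: "r < N" "c < N"
      have "cinner (bop_apply ((\<psi> P + \<psi> Q) $$ (r, c)) x) y =
          cinner (bop_apply (\<psi> P $$ (r, c)) x) y + cinner (bop_apply (\<psi> Q $$ (r, c)) x) y"
        using rc by (simp add: \<psi>_dim bop_apply_add cinner_add_left)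
      thus "cinner (bop_apply (\<psi> (P + Q) $$ (r, c)) x) y = cinner (bop_apply ((\<psi> P + \<psi> Q) $$ (r, c)) x) y"
        using rc by (simp add: P Q \<psi>_entry off_less cp_form_add[OF \<sigma>] sum.distrib)
    qed
  qed
  moreover have "op_positive (k * N) (assemble (replicate k N) (\<lambda>a b. \<psi> (Q a b)))"
    if pos: "cstar_positive (k * N) (assemble (replicate k N) Q)" for k Q
  proof -
    define bl where "bl c = fst (locate (replicate k N) c)" for c
    define r where "r c = snd (locate (replicate k N) c)" for c
    have bl: "bl c < k" "r c < N" if "c < k * N" for c
      using locate_less[of c "replicate k N"] that by (auto simp: bl_def r_def sum_list_replicate)
    \<comment> \<open>\<open>col c l\<close> is the column in the same copy and in the same part of
      \<open>ns\<close> as \<open>c\<close>, at position \<open>l\<close> of that part.\<close>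
    define col where "col c l = bl c * N + (off (r c) + l)" for c l
    have off_col: "sum_list (take (bl c) (replicate k N)) = bl c * N" if "c < k * N" for c
      using bl(1)[OF that] by (simp add: sum_list_replicate)
    obtain B where B: "B \<in> carrier_mat (k * N) (k * N)" "assemble (replicate k N) Q = star_mat B * B"
      using pos by (auto simp: cstar_positive_def)
    have Q_entry: "Q (bl c) (bl d) $$ (off (r c) + l, off (r d) + l') =
        (\<Sum>t<k * N. star (B $$ (t, col c l)) * B $$ (t, col d l'))"
      if cd: "c < k * N" "d < k * N" and l: "l < ns ! z (r c)" "l' < ns ! z (r d)" for c d l l'
    proof -
      have lt: "off (r c) + l < N" "off (r d) + l' < N" using cd l off_less bl(2) by auto
      have "col c l < k * N" "col d l' < k * N"
        using offset_less[of "bl c" "replicate k N" "off (r c) + l"] offset_less[of "bl d" "replicate k N" "off (r d) + l'"]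
          lt bl(1) cd by (simp_all add: sum_list_replicate off_col col_def)
      hence "(star_mat B * B) $$ (col c l, col d l') = (\<Sum>t<k * N. star (B $$ (t, col c l)) * B $$ (t, col d l'))"
        using B(1) by (simp add: star_mat_def scalar_prod_def atLeast0LessThan)
      moreover have "assemble (replicate k N) Q $$ (col c l, col d l') = Q (bl c) (bl d) $$ (off (r c) + l, off (r d) + l')"
        using assemble_index[of "bl c" "replicate k N" "off (r c) + l" "bl d" "off (r d) + l'" Q] lt bl(1) cd
        by (simp add: sum_list_replicate col_def)
      ultimately show ?thesis by (simp add: B(2))
    qed
    show ?thesis
      unfolding op_positive_iff
    proof (intro conjI ballI)
      show "assemble (replicate k N) (\<lambda>a b. \<psi> (Q a b)) \<in> carrier_mat (k * N) (k * N)"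
        using assemble_carrier[of "replicate k N"] by (simp add: sum_list_replicate)
      fix y :: "'y vec"
      \<comment> \<open>The pair \<open>(c, l)\<close> yields the generator whose matrix-unit label
        is \<open>l\<close>, while its point, entry position and vector are those of index
        \<open>c\<close>.\<close>
      define gen where "gen p = (Zs ! z (r (fst p)), snd p, i (r (fst p)), y $ fst p)" for p :: "nat \<times> nat"
      define I where "I = Sigma {..<k * N} (\<lambda>c. {..<ns ! z (r c)})"
      have I: "finite I" by (simp add: I_def)
      have sum_I: "(\<Sum>p\<in>I. f p) = (\<Sum>c<k * N. \<Sum>l<ns ! z (r c). f (c, l))" for f :: "_ \<Rightarrow> complex"
        by (simp add: I_def sum.Sigma)
      have "(\<Sum>c<k * N. \<Sum>d<k * N. cinner (bop_apply (assemble (replicate k N) (\<lambda>a b. \<psi> (Q a b)) $$ (c, d)) (y $ d)) (y $ c))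
        = (\<Sum>c<k * N. \<Sum>d<k * N. \<Sum>l<ns ! z (r c). \<Sum>l'<ns ! z (r d). \<Sum>t<k * N.
            \<sigma> (star (B $$ (t, col c l)) * B $$ (t, col d l')) (gen (c, l)) (gen (d, l')))"
      proof (rule sum.cong[OF refl], rule sum.cong[OF refl])
        fix c d assume "c \<in> {..<k * N}" "d \<in> {..<k * N}"
        hence cd: "c < k * N" "d < k * N" by auto
        have "assemble (replicate k N) (\<lambda>a b. \<psi> (Q a b)) $$ (c, d) = \<psi> (Q (bl c) (bl d)) $$ (r c, r d)"
          using cd by (simp add: assemble_def sum_list_replicate bl_def r_def case_prod_beta Let_def)
        thus "cinner (bop_apply (assemble (replicate k N) (\<lambda>a b. \<psi> (Q a b)) $$ (c, d)) (y $ d)) (y $ c) =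
          (\<Sum>l<ns ! z (r c). \<Sum>l'<ns ! z (r d). \<Sum>t<k * N.
            \<sigma> (star (B $$ (t, col c l)) * B $$ (t, col d l')) (gen (c, l)) (gen (d, l')))"
          using cd bl(2) by (simp add: \<psi>_entry Q_entry cp_form_sum[OF \<sigma>] gen_def)
      qed
      also have "\<dots> = (\<Sum>p\<in>I. \<Sum>q\<in>I. \<Sum>t<k * N.
          \<sigma> (star (B $$ (t, col (fst p) (snd p))) * B $$ (t, col (fst q) (snd q))) (gen p) (gen q))"
        unfolding sum_I by (rule sum.cong[OF refl], subst sum.swap, simp)
      also have "\<dots> = (\<Sum>p\<in>I. \<Sum>t<k * N. \<Sum>q\<in>I.
          \<sigma> (star (B $$ (t, col (fst p) (snd p))) * B $$ (t, col (fst q) (snd q))) (gen p) (gen q))"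
        by (rule sum.cong[OF refl], rule sum.swap)
      also have "\<dots> = (\<Sum>t<k * N. \<Sum>p\<in>I. \<Sum>q\<in>I.
          \<sigma> (star (B $$ (t, col (fst p) (snd p))) * B $$ (t, col (fst q) (snd q))) (gen p) (gen q))"
        by (rule sum.swap)
      also have "0 \<le> \<dots>"
        by (intro sum_nonneg cp_form_pos_family[OF \<sigma> I])
      finally show "0 \<le> (\<Sum>c<k * N. \<Sum>d<k * N.
          cinner (bop_apply (assemble (replicate k N) (\<lambda>a b. \<psi> (Q a b)) $$ (c, d)) (y $ d)) (y $ c))" .
    qed
  qed
  ultimately show ?thesis
    unfolding completely_positive_def \<psi>_def[symmetric] N_def[symmetric] using \<psi>_carrier by blast
qed

lemma K'_cp_nc_kernel: "cp_nc_kernel \<Omega> UNIV K'"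
  unfolding cp_nc_kernel_def Let_def using K'_nc_kernel K'_completely_positive by blast

end

theorem theorem6p1:
  fixes \<Omega> :: "'v::complex_vector mat set"
    and S :: "'a::cstar_algebra set"
    and K :: "'v mat \<Rightarrow> 'v mat \<Rightarrow> 'a mat \<Rightarrow> 'y::chilbert_space bop mat"
  assumes "\<Omega> \<subseteq> nc_space"
    and "operator_system S"
    and "cp_nc_kernel \<Omega> S K"
  shows "\<exists>K' :: 'v mat \<Rightarrow> 'v mat \<Rightarrow> 'a mat \<Rightarrow> 'y bop mat.
    cp_nc_kernel \<Omega> UNIV K' \<and>
    (\<forall>n m. \<forall>Z \<in> graded_level \<Omega> n. \<forall>W \<in> graded_level \<Omega> m. \<forall>P \<in> mats S n m.
       K' Z W P = K Z W P)"
proof -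
  have K: "nc_kernel \<Omega> S K" using assms(3) by (simp add: cp_nc_kernel_def)
  have "\<exists>\<sigma>. cp_form \<sigma> \<and> (\<forall>a\<in>S. \<forall>g\<in>generators \<Omega>. \<forall>h\<in>generators \<Omega>. \<sigma> a g h = nc_form K a g h)"
    by (rule kernel_extension[OF assms(2)])
       (simp_all add: nc_form_linear[OF assms(1,2) K] nc_form_positive[OF assms])
  then obtain \<sigma> where "cp_form \<sigma>"
    "\<And>a g h. a \<in> S \<Longrightarrow> g \<in> generators \<Omega> \<Longrightarrow> h \<in> generators \<Omega> \<Longrightarrow> \<sigma> a g h = nc_form K a g h"
    by blast
  then interpret nc_form_extension \<Omega> S K \<sigma>
    using assms K by unfold_locales
  show ?thesis
    using K'_cp_nc_kernel K'_extends
    by (intro exI[of _ "kernel_of_form \<sigma>"]) (auto simp: graded_level_iff[OF assms(1)])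
qed

end
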